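(* Let \[ \mathcal{L}_2 := \left\{ \left[ \bar{\alpha}^2 + \bar{\beta}^2 : \sqrt{2}(\bar{\alpha} \beta - \alpha \bar{\beta}) : \alpha^2 + \beta^2 \right] \;\middle|\; \alpha, \beta \in \mathbb{C},\ |\alpha|^2+|\beta|^2=1 \right\} \subset \mathbb{CP}^2 , \] let $a=-\frac16$, and let $M_{red} = \mu_2^{-1}(a)/S^1 \simeq \mathbb{CP}^1$ be the reduced space of $\mathbb{CP}^2$ at level $a$ with respect to the circle action $e^{i\theta}\cdot[z_0:z_1:z_2]=[z_0:z_1:e^{i\theta}z_2]$ with moment map $\mu_2$. Then the lagrangian submanifold $\mathcal{L}_2$ is a one-to-one transverse lifting of a great circle $\ell_2$ in $\mathbb{CP}^1$.
   Context: $\mathbb{CP}^2$ carries the Fubini-Study symplectic form $\omega$ scaled so that the total volume is $\frac{\pi^2}{2}$ (i.e. the reduction of $\frac{i}{2}\sum_{j=0}^2 du_j\wedge d\bar u_j$ on $\mathbb{C}^3$ at the unit sphere by the diagonal circle action). The moment map of the circle action $[z_0:z_1:z_2]\mapsto[z_0:z_1:e^{i\theta}z_2]$ is \[ \mu_2 : \mathbb{CP}^2\to\mathbb{R},\qquad \mu_2[z_0:z_1:z_2] = -\frac12\,\frac{|z_2|^2}{|z_0|^2+|z_1|^2+|z_2|^2}. \] Let $\pi:\mu_2^{-1}(a)\to M_{red}=\mu_2^{-1}(a)/S^1$ be the point-orbit projection and $\imath:\mu_2^{-1}(a)\hookrightarrow \mathbb{CP}^2$ the inclusion. The reduced symplectic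 form $\omega_{red}$ on $M_{red}$ is determined by $\pi^*\omega_{red}=\imath^*\omega$. The reduced space $(M_{red},\omega_{red})$ is identified with $\mathbb{CP}^1$ (the orbit of $[z_0:z_1:z_2]$ corresponding to $[z_0:z_1]$) with a scaled Fubini-Study form of total area $\frac{2\pi}{3}$. A great circle in $\mathbb{CP}^1$ is a great circle of the round 2-sphere given by the Fubini-Study metric. Definition (one-to-one transverse lifting). Let $L\subset\mathbb{CP}^2$ be a compact lagrangian submanifold such that (i) $L$ and $\mu_2^{-1}(a)$ intersect transversally, and (ii) $L$ intersects each $S^1$-orbit in $\mu_2^{-1}(a)$ at most once, i.e. $\pi$ is injective on $L\cap\mu_2^{-1}(a)$. Then $\ell:=\pi(L\cap\mu_2^{-1}(a))$ is an embedded lagrangian submanifold of $(M_{red},\omega_{red})$, and $L$ is called a one-to-one transverse lifting of $\ell$. *)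

theory Defs
  imports "HOL-Analysis.Analysis"
begin

section \<open>Smooth maps and submanifolds of Euclidean spaces\<close>

primrec ck_on :: "nat \<Rightarrow> 'a::euclidean_space set \<Rightarrow> ('a \<Rightarrow> 'b::euclidean_space) \<Rightarrow> bool" where
  "ck_on 0 S f \<longleftrightarrow> continuous_on S f"
| "ck_on (Suc k) S f \<longleftrightarrow>
     (\<forall>x\<in>S. f differentiable (at x)) \<and> (\<forall>v. ck_on k S (\<lambda>x. frechet_derivative f (at x) v))"

definition smooth_on :: "'a::euclidean_space set \<Rightarrow> ('a \<Rightarrow> 'b::euclidean_space) \<Rightarrow> bool" where
  "smooth_on S f \<longleftrightarrow> open S \<and> (\<forall>k. ck_on k S f)"

definition smooth_diffeo :: "'a::euclidean_space set \<Rightarrow> 'a set \<Rightarrow> ('a \<Rightarrow> 'a) \<Rightarrow> bool" where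
  "smooth_diffeo N N' \<Phi> \<longleftrightarrow>
     smooth_on N \<Phi> \<and> \<Phi> ` N = N' \<and> (\<exists>\<Psi>. smooth_on N' \<Psi> \<and> (\<forall>x\<in>N. \<Psi> (\<Phi> x) = x))"

text \<open>Embedded submanifolds, by local flattening.\<close>

definition smooth_submanifold :: "nat \<Rightarrow> 'a::euclidean_space set \<Rightarrow> bool" where
  "smooth_submanifold k S \<longleftrightarrow>
     (\<forall>x\<in>S. \<exists>N N' \<Phi> K. x \<in> N \<and> smooth_diffeo N N' \<Phi> \<and>
        subspace K \<and> dim K = k \<and> \<Phi> ` (S \<inter> N) = K \<inter> N')"

definition tangent_vectors :: "'a::euclidean_space set \<Rightarrow> 'a \<Rightarrow> 'a set" where
  "tangent_vectors S x =
     {v. \<exists>c. \<exists>e>0. smooth_on {-e<..<e} c \<and> c ` {-e<..<e} \<subseteq> S \<and> c (0::real) = x \<and>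
           (c has_vector_derivative v) (at 0)}"


section \<open>Complex projective space\<close>

definition proportional :: "complex^'n \<Rightarrow> complex^'n \<Rightarrow> bool" where
  "proportional z w \<longleftrightarrow> z \<noteq> 0 \<and> w \<noteq> 0 \<and> (\<exists>c. w = c *s z)"

lemma proportional_iff: "proportional z w \<longleftrightarrow> z \<noteq> 0 \<and> (\<exists>c. c \<noteq> 0 \<and> w = c *s z)"
  by (auto simp: proportional_def vec_eq_iff)

lemma part_equivp_proportional: "part_equivp (proportional :: complex^'n \<Rightarrow> _)"
proof (rule part_equivpI)
  show "\<exists>x. proportional (x :: complex^'n) x"
    by (rule exI[of _ 1], auto simp: proportional_def vec_eq_iff intro!: exI[of _ 1])
  show "symp (proportional :: complex^'n \<Rightarrow> _)"
  proof (rule sympI)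
    fix x y :: "complex^'n"
    assume "proportional x y"
    then obtain c where "x \<noteq> 0" "c \<noteq> 0" "y = c *s x"
      by (auto simp: proportional_iff)
    then show "proportional y x"
      by (auto simp: proportional_iff vec_eq_iff intro!: exI[of _ "inverse c"])
  qed
  show "transp (proportional :: complex^'n \<Rightarrow> _)"
  proof (rule transpI)
    fix x y z :: "complex^'n"
    assume "proportional x y" "proportional y z"
    then show "proportional x z"
      by (auto simp: proportional_def vector_smult_assoc)
  qed
qed

text \<open>
  The type \<open>'n cproj\<close> is the projective space of \<open>complex^'n\<close>, of complex dimension
  \<open>CARD('n) - 1\<close>; so \<open>3 cproj\<close> is the projective plane.  The homogeneous coordinates
  $z_0, z_1, z_2$ are \<open>z $ 1\<close>, \<open>z $ 2\<close>, \<open>z $ 3\<close>, in accordance with \<open>vector [z0, z1, z2]\<close>.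
\<close>

quotient_type 'n cproj = "complex^'n" / partial: proportional
  by (rule part_equivp_proportional)

text \<open>\<open>proj z\<close> is the point with homogeneous coordinates \<open>z\<close>; it is meaningful for \<open>z \<noteq> 0\<close> only.\<close>

definition proj :: "complex^'n \<Rightarrow> 'n cproj" where
  "proj z = abs_cproj z"

lemma proj_eq_iff: "z \<noteq> 0 \<Longrightarrow> w \<noteq> 0 \<Longrightarrow> proj z = proj w \<longleftrightarrow> proportional z w"
  unfolding proj_def
  using Quotient_rel[OF Quotient_cproj, of z w]
  by (auto simp: proportional_def vec_eq_iff intro!: exI[of _ 1])

lemma proj_cases: obtains z where "z \<noteq> 0" "p = proj z"
  unfolding proj_def
  using Quotient_abs_rep[OF Quotient_cproj, of p] Quotient_rep_reflp[OF Quotient_cproj, of p]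
  by (metis proportional_def)

lemma proj_scale: "z \<noteq> 0 \<Longrightarrow> c \<noteq> 0 \<Longrightarrow> proj (c *s z) = proj z"
  by (subst eq_commute, subst proj_eq_iff) (auto simp: proportional_iff vec_eq_iff)

text \<open>The quotient topology.\<close>

instantiation cproj :: (finite) topological_space
begin

definition open_cproj :: "'a cproj set \<Rightarrow> bool" where
  "open_cproj U \<longleftrightarrow> open {z. z \<noteq> 0 \<and> proj z \<in> U}"

instance
proof
  show "open (UNIV :: 'a cproj set)"
    unfolding open_cproj_def by (simp add: open_Collect_neq)
next
  fix S T :: "'a cproj set"
  assume "open S" "open T"
  then have "open ({z. z \<noteq> 0 \<and> proj z \<in> S} \<inter> {z. z \<noteq> 0 \<and> proj z \<in> T})"
    unfolding open_cproj_def by (rule open_Int)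
  also have "{z. z \<noteq> 0 \<and> proj z \<in> S} \<inter> {z. z \<noteq> 0 \<and> proj z \<in> T} = {z. z \<noteq> 0 \<and> proj z \<in> S \<inter> T}"
    by auto
  finally show "open (S \<inter> T)"
    unfolding open_cproj_def .
next
  fix K :: "'a cproj set set"
  assume "\<forall>S\<in>K. open S"
  then have "open (\<Union>S\<in>K. {z. z \<noteq> 0 \<and> proj z \<in> S})"
    unfolding open_cproj_def by (intro open_UN) auto
  also have "(\<Union>S\<in>K. {z. z \<noteq> 0 \<and> proj z \<in> S}) = {z. z \<noteq> 0 \<and> proj z \<in> \<Union>K}"
    by auto
  finally show "open (\<Union>K)"
    unfolding open_cproj_def .
qed

end

text \<open>
  The affine chart number \<open>j\<close> sends $[z]$ to $z / z_j$.  Its values lie in the affine hyperplane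
  \<open>{x. x $ j = 1}\<close> of \<open>complex^'n\<close>, which plays the role of $\mathbb{C}^m$ for
  \<open>m = CARD('n) - 1\<close>; coordinate vectors of tangent vectors accordingly lie in \<open>{\<xi>. \<xi> $ j = 0}\<close>.
\<close>

definition chart_dom :: "'n \<Rightarrow> 'n::finite cproj set" where
  "chart_dom j = {p. \<exists>x. x $ j = 1 \<and> p = proj x}"

definition chart :: "'n \<Rightarrow> 'n::finite cproj \<Rightarrow> complex^'n" where
  "chart j p = (THE x. x $ j = 1 \<and> p = proj x)"

lemma chart_proj: 
  assumes "z $ j \<noteq> 0"
  shows "proj z \<in> chart_dom j" "chart j (proj z) = (1 / z $ j) *s z"
proof -
  have z: "z \<noteq> 0" using assms by auto
  let ?x = "(1 / z $ j) *s z"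
  have x: "?x $ j = 1" "proj z = proj ?x"
    using assms z by (auto simp: proj_scale)
  then show "proj z \<in> chart_dom j"
    unfolding chart_dom_def by blast
  show "chart j (proj z) = ?x"
    unfolding chart_def
  proof (rule the_equality)
    fix y assume y: "y $ j = 1 \<and> proj z = proj y"
    then have "y \<noteq> 0" by auto
    then have "proportional z y" using y z by (metis proj_eq_iff)
    then obtain c where "y = c *s z" by (auto simp: proportional_def)
    with y assms show "y = ?x" by (auto simp: field_simps)
  qed (use x in blast)
qed

text \<open>Subsets of projective space are submanifolds iff they are so in every affine chart.\<close>

definition cproj_submanifold :: "nat \<Rightarrow> 'n::finite cproj set \<Rightarrow> bool" where
  "cproj_submanifold k L \<longleftrightarrow> (\<forall>j. smooth_submanifold k (chart j ` (L \<inter> chart_dom j)))"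

text \<open>\<open>tangent j L p\<close> is the tangent space of \<open>L\<close> at \<open>p \<in> chart_dom j\<close>, read in the chart \<open>j\<close>.\<close>

definition tangent :: "'n \<Rightarrow> 'n::finite cproj set \<Rightarrow> 'n cproj \<Rightarrow> (complex^'n) set" where
  "tangent j L p = tangent_vectors (chart j ` (L \<inter> chart_dom j)) (chart j p)"

definition transverse :: "'n::finite cproj set \<Rightarrow> 'n cproj set \<Rightarrow> bool" where
  "transverse L M \<longleftrightarrow>
     (\<forall>p \<in> L \<inter> M. \<forall>j. p \<in> chart_dom j \<longrightarrow>
        {\<xi> + \<eta> |\<xi> \<eta>. \<xi> \<in> tangent j L p \<and> \<eta> \<in> tangent j M p} = tangent j UNIV p)"


section \<open>The Fubini-Study form\<close>

text \<open>The form $\frac{i}{2} \sum_j du_j \wedge d\bar u_j$.\<close>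

definition std_form :: "complex^'n \<Rightarrow> complex^'n \<Rightarrow> real" where
  "std_form u v = (\<Sum>j\<in>UNIV. Im (cnj (u $ j) * v $ j))"

text \<open>
  The reduction \<open>\<omega>\<close> of \<open>std_form\<close> at the unit sphere is determined by $\pi^*\omega = \iota^*$\<open>std_form\<close>
  for the Hopf map $\pi$ from the unit sphere and its inclusion $\iota$.  As \<open>x \<mapsto> x / \<parallel>x\<parallel>\<close> is a local
  section of $\pi$, the form \<open>\<omega>\<close> in the chart \<open>j\<close> is the pullback of \<open>std_form\<close> under it.  That this
  does have the determining property is \<open>fubini_study_pullback\<close> below.
\<close>

definition fubini_study :: "'n \<Rightarrow> 'n::finite cproj \<Rightarrow> complex^'n \<Rightarrow> complex^'n \<Rightarrow> real" where
  "fubini_study j p \<xi> \<eta> =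
     (let D = frechet_derivative (\<lambda>x. x /\<^sub>R norm x) (at (chart j p))
      in std_form (D \<xi>) (D \<eta>))"

text \<open>Lagrangian submanifolds have half the real dimension \<open>2 * (CARD('n) - 1)\<close>.\<close>

definition lagrangian_submanifold :: "'n::finite cproj set \<Rightarrow> bool" where
  "lagrangian_submanifold L \<longleftrightarrow>
     cproj_submanifold (CARD('n) - 1) L \<and>
     (\<forall>p\<in>L. \<forall>j. p \<in> chart_dom j \<longrightarrow>
        (\<forall>\<xi> \<in> tangent j L p. \<forall>\<eta> \<in> tangent j L p. fubini_study j p \<xi> \<eta> = 0))"

lemma std_form_add_left: "std_form (u + u') v = std_form u v + std_form u' v"
  by (simp add: std_form_def algebra_simps flip: sum.distrib)

lemma std_form_add_right: "std_form u (v + v') = std_form u v + std_form u v'"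
  by (simp add: std_form_def algebra_simps flip: sum.distrib)

lemma std_form_scale: "std_form (c *s u) (c *s v) = (cmod c)\<^sup>2 * std_form u v"
  unfolding std_form_def sum_distrib_left cmod_power2
  by (rule sum.cong) (auto simp: algebra_simps power2_eq_square)

lemma std_form_iscale_left: "std_form ((\<i> * of_real s) *s z) v = - s * (z \<bullet> v)"
  unfolding std_form_def inner_vec_def sum_distrib_left
  by (rule sum.cong) (auto simp: inner_complex_def algebra_simps)

lemma std_form_iscale_right: "std_form u ((\<i> * of_real s) *s z) = s * (z \<bullet> u)"
  unfolding std_form_def inner_vec_def sum_distrib_left
  by (rule sum.cong) (auto simp: inner_complex_def algebra_simps)

lemma norm_smult_complex: "norm (c *s z) = cmod c * norm z" for z :: "complex^'n"
  by (simp add: norm_vec_def L2_set_def norm_mult power_mult_distrib real_sqrt_mult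
      flip: sum_distrib_left)

lemma inner_smult_complex:
  "(c *s u) \<bullet> (c *s v) = (cmod c)\<^sup>2 * (u \<bullet> v)" for u v :: "complex^'n"
  unfolding inner_vec_def sum_distrib_left cmod_power2
  by (rule sum.cong) (auto simp: inner_complex_def algebra_simps power2_eq_square)

lemma inner_smult_self: "z \<bullet> (b *s z) = Re b * (norm z)\<^sup>2" for z :: "complex^'n"
  unfolding power2_norm_eq_inner inner_vec_def sum_distrib_left
  by (rule sum.cong) (auto simp: inner_complex_def algebra_simps)

lemma has_derivative_normalize:
  fixes x :: "complex^'n"
  assumes "x \<noteq> 0"
  shows "((\<lambda>x. x /\<^sub>R norm x) has_derivative (\<lambda>\<xi>. \<xi> /\<^sub>R norm x - (x \<bullet> \<xi> / norm x ^ 3) *\<^sub>R x)) (at x)"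
proof -
  have n: "(norm has_derivative (\<lambda>\<xi>. sgn x \<bullet> \<xi>)) (at x)"
    using has_derivative_norm[OF assms] by (simp add: inner_commute)
  have i: "((\<lambda>x. inverse (norm x)) has_derivative (\<lambda>\<xi>. - (inverse (norm x) * (sgn x \<bullet> \<xi>) * inverse (norm x)))) (at x)"
    using Deriv.has_derivative_inverse[OF _ n] assms by simp
  show ?thesis
    by (rule has_derivative_eq_rhs, rule has_derivative_scaleR[OF i has_derivative_ident])
       (use assms in \<open>auto simp: fun_eq_iff sgn_div_norm power3_eq_cube divide_simps\<close>)
qed

lemma bounded_bilinear_smult: "bounded_bilinear ((*s) :: complex \<Rightarrow> complex^'n \<Rightarrow> _)"
proof
  show "\<exists>K. \<forall>a (b :: complex^'n). norm (a *s b) \<le> norm a * norm b * K"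
    by (rule exI[of _ 1]) (simp add: norm_smult_complex)
qed (simp_all add: vec_eq_iff algebra_simps)

lemma has_derivative_chart:
  fixes z :: "complex^'n"
  assumes "z $ j \<noteq> 0"
  shows "((\<lambda>y. (1 / y $ j) *s y) has_derivative
           (\<lambda>u. (1 / z $ j) *s (u - (u $ j / z $ j) *s z))) (at z)"
proof -
  have nth: "((\<lambda>y. y $ j) has_derivative (\<lambda>u. u $ j)) (at z)"
    by (rule bounded_linear_imp_has_derivative[OF bounded_linear_vec_nth])
  have "((\<lambda>y. 1 / y $ j) has_derivative (\<lambda>u. (0 * z $ j - 1 * u $ j) / (z $ j * z $ j))) (at z)"
    by (rule has_derivative_divide'[OF has_derivative_const nth assms])
  from bounded_bilinear.FDERIV[OF bounded_bilinear_smult this has_derivative_ident]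
  show ?thesis
    by (rule has_derivative_eq_rhs) (use assms in \<open>simp add: fun_eq_iff vec_eq_iff field_simps\<close>)
qed

lemma fubini_study_pullback_scaled:
  fixes z u v :: "complex^'n"
  assumes z: "z $ j \<noteq> 0" and u: "z \<bullet> u = 0" and v: "z \<bullet> v = 0"
  defines "D \<equiv> frechet_derivative (\<lambda>y. (1 / y $ j) *s y) (at z)"
  shows "fubini_study j (proj z) (D u) (D v) = std_form u v / (norm z)\<^sup>2"
proof -
  have D: "D = (\<lambda>u. (1 / z $ j) *s (u - (u $ j / z $ j) *s z))"
    unfolding D_def using frechet_derivative_at[OF has_derivative_chart[OF z]] by simp
  have z0: "z \<noteq> 0" "norm z > 0" using z by auto
  define x where "x = (1 / z $ j) *s z"
  have x: "x \<noteq> 0" using z by (auto simp: x_def vec_eq_iff)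
  have nx: "norm x = norm z / cmod (z $ j)"
    by (simp add: x_def norm_smult_complex norm_divide)
  define E where "E = frechet_derivative (\<lambda>x. x /\<^sub>R norm x) (at x)"
  have E: "E = (\<lambda>\<xi>. \<xi> /\<^sub>R norm x - (x \<bullet> \<xi> / norm x ^ 3) *\<^sub>R x)"
    unfolding E_def using frechet_derivative_at[OF has_derivative_normalize[OF x]] by simp
  define k where "k = of_real (cmod (z $ j) / norm z) / z $ j"
  have k: "cmod k = 1 / norm z"
    using z by (simp add: k_def norm_divide norm_mult)
  have ED: "E (D u) = k *s (u + (\<i> * of_real (- Im (u $ j / z $ j))) *s z)"
    if u: "z \<bullet> u = 0" for u
  proof -
    define b where "b = u $ j / z $ j"
    have "x \<bullet> D u = (cmod (1 / z $ j))\<^sup>2 * (z \<bullet> (u - b *s z))"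
      unfolding D x_def b_def by (rule inner_smult_complex)
    also have "\<dots> = - (Re b * (norm z)\<^sup>2 / (cmod (z $ j))\<^sup>2)"
      by (simp add: inner_diff_right u inner_smult_self norm_divide power_divide)
    finally have "x \<bullet> D u = - (Re b * (norm z)\<^sup>2 / (cmod (z $ j))\<^sup>2)" .
    then have xD: "x \<bullet> D u / norm x ^ 3 = - (Re b * cmod (z $ j) / norm z)"
      using z z0 by (simp only: nx) (simp add: divide_simps power2_eq_square power3_eq_cube)
    have "E (D u) = D u /\<^sub>R norm x + (Re b * cmod (z $ j) / norm z) *\<^sub>R x"
      by (simp add: E xD)
    also have "\<dots> = k *s ((u - b *s z) + of_real (Re b) *s z)"
      unfolding nx unfolding D b_def[symmetric] x_def k_def using z z0
      by (simp add: vec_eq_iff scaleR_conv_of_real[where 'a = complex] field_simps)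
    also have "(u - b *s z) + of_real (Re b) *s z = u + (\<i> * of_real (- Im b)) *s z"
      by (subst (1) complex_eq[of b]) (simp add: vec_eq_iff algebra_simps)
    finally show ?thesis by (simp add: b_def)
  qed
  have "fubini_study j (proj z) (D u) (D v) = std_form (E (D u)) (E (D v))"
    by (simp add: fubini_study_def chart_proj(2)[OF z] E_def x_def Let_def)
  also have "\<dots> = (cmod k)\<^sup>2 * std_form u v"
    unfolding ED[OF u] ED[OF v] std_form_scale
    by (simp only: std_form_add_left std_form_add_right std_form_iscale_left
          std_form_iscale_right inner_add_right u v inner_smult_self) simp
  finally show ?thesis by (simp add: k power_divide)
qed

theorem fubini_study_pullback:
  fixes z u v :: "complex^'n"
  assumes "norm z = 1" "z $ j \<noteq> 0" "z \<bullet> u = 0" "z \<bullet> v = 0"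
  defines "D \<equiv> frechet_derivative (\<lambda>y. (1 / y $ j) *s y) (at z)"
  shows "fubini_study j (proj z) (D u) (D v) = std_form u v"
  using fubini_study_pullback_scaled[of z j u v] assms by simp


section \<open>The circle action on the projective plane and its reduction\<close>

lift_definition moment :: "3 cproj \<Rightarrow> real"
  is "\<lambda>z. - (1/2) * ((cmod (z $ 3))\<^sup>2 / ((cmod (z $ 1))\<^sup>2 + (cmod (z $ 2))\<^sup>2 + (cmod (z $ 3))\<^sup>2))"
proof -
  fix z w :: "complex^3"
  assume "proportional z w"
  then obtain c where "c \<noteq> 0" "w = c *s z" by (auto simp: proportional_iff)
  moreover have "k * x + k * y + k * t = k * (x + y + t)" for k x y t :: real
    by (simp add: algebra_simps)
  ultimately show "- (1/2) * ((cmod (z $ 3))\<^sup>2 / ((cmod (z $ 1))\<^sup>2 + (cmod (z $ 2))\<^sup>2 + (cmod (z $ 3))\<^sup>2)) =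
    - (1/2) * ((cmod (w $ 3))\<^sup>2 / ((cmod (w $ 1))\<^sup>2 + (cmod (w $ 2))\<^sup>2 + (cmod (w $ 3))\<^sup>2))"
    by (simp add: norm_mult power_mult_distrib del: distrib_left_numeral)
qed

lift_definition circle_act :: "real \<Rightarrow> 3 cproj \<Rightarrow> 3 cproj"
  is "\<lambda>\<theta> z. vector [z $ 1, z $ 2, cis \<theta> * z $ 3]"
  by (fastforce simp: proportional_iff vec_eq_iff forall_3 vector_3 cis_neq_zero)

definition orbit :: "3 cproj \<Rightarrow> 3 cproj set" where
  "orbit p = range (\<lambda>\<theta>. circle_act \<theta> p)"

definition level :: "real \<Rightarrow> 3 cproj set" where
  "level a = {p. moment p = a}"

text \<open>The reduced space as a set of orbits; \<open>orbit\<close> restricted to \<open>level a\<close> is the projection.\<close>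

definition reduced_space :: "real \<Rightarrow> 3 cproj set set" where
  "reduced_space a = orbit ` level a"

text \<open>The orbit of $[z_0 : z_1 : z_2]$ corresponds to $[z_0 : z_1]$.\<close>

definition reduced_to_CP1 :: "3 cproj set \<Rightarrow> 2 cproj" where
  "reduced_to_CP1 X = (THE q. \<exists>z. z \<noteq> 0 \<and> proj z \<in> X \<and> q = proj (vector [z $ 1, z $ 2]))"

definition one_to_one_transverse_lifting :: "real \<Rightarrow> 3 cproj set \<Rightarrow> 3 cproj set set \<Rightarrow> bool" where
  "one_to_one_transverse_lifting a L l \<longleftrightarrow>
     compact L \<and> lagrangian_submanifold L \<and>
     transverse L (level a) \<and>
     inj_on orbit (L \<inter> level a) \<and>
     l = orbit ` (L \<inter> level a)"

lemma moment_proj: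
  "z \<noteq> 0 \<Longrightarrow> moment (proj z) =
     - (1/2) * ((cmod (z $ 3))\<^sup>2 / ((cmod (z $ 1))\<^sup>2 + (cmod (z $ 2))\<^sup>2 + (cmod (z $ 3))\<^sup>2))"
  unfolding proj_def
  by (subst moment.abs_eq) (auto simp: proportional_iff intro!: exI[of _ 1])

lemma circle_act_proj:
  "z \<noteq> 0 \<Longrightarrow> circle_act \<theta> (proj z) = proj (vector [z $ 1, z $ 2, cis \<theta> * z $ 3])"
  unfolding proj_def
  by (subst circle_act.abs_eq) (auto simp: proportional_iff intro!: exI[of _ 1])

lemma reduced_to_CP1_orbit:
  assumes "z $ 1 \<noteq> 0 \<or> z $ 2 \<noteq> 0"
  shows "reduced_to_CP1 (orbit (proj z)) = proj (vector [z $ 1, z $ 2])"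
proof -
  have z: "z \<noteq> 0" using assms by auto
  have n: "vector [z $ 1, z $ 2] \<noteq> (0 :: complex^2)"
    using assms by (auto simp: vec_eq_iff forall_2)
  show ?thesis
    unfolding reduced_to_CP1_def
  proof (rule the_equality)
    have "vector [z $ 1, z $ 2, cis 0 * z $ 3] = z"
      by (simp add: vec_eq_iff forall_3)
    then have "circle_act 0 (proj z) = proj z"
      using circle_act_proj[OF z, of 0] by simp
    then have "proj z \<in> orbit (proj z)"
      unfolding orbit_def by (metis rangeI)
    with z show "\<exists>w. w \<noteq> 0 \<and> proj w \<in> orbit (proj z) \<and>
        proj (vector [z $ 1, z $ 2]) = (proj (vector [w $ 1, w $ 2]) :: 2 cproj)"
      by blast
  next
    fix q :: "2 cproj"
    assume "\<exists>w. w \<noteq> 0 \<and> proj w \<in> orbit (proj z) \<and> q = proj (vector [w $ 1, w $ 2])"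
    then obtain w :: "complex^3" and \<theta> where w: "w \<noteq> 0" "q = proj (vector [w $ 1, w $ 2])"
      and e: "proj w = proj (vector [z $ 1, z $ 2, cis \<theta> * z $ 3])"
      by (auto simp: orbit_def circle_act_proj[OF z])
    have "vector [z $ 1, z $ 2, cis \<theta> * z $ 3] \<noteq> (0 :: complex^3)"
      using assms by (auto simp: vec_eq_iff forall_3)
    with e w have "proportional (vector [z $ 1, z $ 2, cis \<theta> * z $ 3]) w"
      by (metis proj_eq_iff)
    then obtain c where c: "c \<noteq> 0" "w = c *s vector [z $ 1, z $ 2, cis \<theta> * z $ 3]"
      by (auto simp: proportional_iff)
    then have "vector [w $ 1, w $ 2] = c *s (vector [z $ 1, z $ 2] :: complex^2)"
      by (simp add: vec_eq_iff forall_2)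
    with w c n show "q = proj (vector [z $ 1, z $ 2])"
      by (simp add: proj_scale)
  qed
qed

lemma circle_act_add: "circle_act \<theta> (circle_act \<phi> p) = circle_act (\<theta> + \<phi>) p"
proof -
  obtain z where z: "z \<noteq> 0" "p = proj z" by (rule proj_cases)
  have "vector [z $ 1, z $ 2, cis \<phi> * z $ 3] \<noteq> (0 :: complex^3)"
    using z by (auto simp: vec_eq_iff forall_3)
  then show ?thesis
    using z by (simp add: circle_act_proj flip: mult.assoc cis_mult)
qed

lemma orbit_circle_act: "orbit (circle_act \<theta> p) = orbit p"
  unfolding orbit_def circle_act_add
  by (auto simp: image_iff) (metis diff_add_cancel)

lemma level_coordinates:
  assumes "z \<noteq> 0" "moment (proj z) = a"
  shows "(cmod (z $ 3))\<^sup>2 * (1 + 2 * a) = - 2 * a * ((cmod (z $ 1))\<^sup>2 + (cmod (z $ 2))\<^sup>2)"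
proof -
  have "(cmod (z $ 1))\<^sup>2 + (cmod (z $ 2))\<^sup>2 + (cmod (z $ 3))\<^sup>2 = (norm z)\<^sup>2"
    by (simp add: norm_vec_def L2_set_def sum_3)
  then have "(cmod (z $ 1))\<^sup>2 + (cmod (z $ 2))\<^sup>2 + (cmod (z $ 3))\<^sup>2 \<noteq> 0"
    using assms by simp
  then show ?thesis
    using assms by (simp add: moment_proj field_simps)
qed

lemma bij_reduced_to_CP1:
  assumes a: "-1/2 < a" "a < 0"
  shows "bij_betw reduced_to_CP1 (reduced_space a) UNIV"
proof -
  have lev: "z $ 1 \<noteq> 0 \<or> z $ 2 \<noteq> 0" if "z \<noteq> 0" "moment (proj z) = a" for z
    using level_coordinates[OF that] a that(1) by (auto simp: vec_eq_iff forall_3)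
  show ?thesis
  proof (rule bij_betwI')
    fix X Y assume "X \<in> reduced_space a" "Y \<in> reduced_space a"
    then obtain p q where pq: "X = orbit p" "Y = orbit q" "moment p = a" "moment q = a"
      by (auto simp: reduced_space_def level_def)
    obtain z where z: "z \<noteq> 0" "p = proj z" by (rule proj_cases)
    obtain w where w: "w \<noteq> 0" "q = proj w" by (rule proj_cases)
    have zn: "z $ 1 \<noteq> 0 \<or> z $ 2 \<noteq> 0" and wn: "w $ 1 \<noteq> 0 \<or> w $ 2 \<noteq> 0"
      using lev z w pq by auto
    show "reduced_to_CP1 X = reduced_to_CP1 Y \<longleftrightarrow> X = Y"
    proof
      assume "reduced_to_CP1 X = reduced_to_CP1 Y"
      then have e: "proj (vector [z $ 1, z $ 2] :: complex^2) = proj (vector [w $ 1, w $ 2])"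
        by (simp add: pq z w reduced_to_CP1_orbit[OF zn] reduced_to_CP1_orbit[OF wn])
      have "vector [z $ 1, z $ 2] \<noteq> (0 :: complex^2)" "vector [w $ 1, w $ 2] \<noteq> (0 :: complex^2)"
        using zn wn by (auto simp: vec_eq_iff forall_2)
      with e have "proportional (vector [z $ 1, z $ 2] :: complex^2) (vector [w $ 1, w $ 2])"
        by (simp add: proj_eq_iff)
      then obtain c where "c \<noteq> 0" "vector [w $ 1, w $ 2] = c *s (vector [z $ 1, z $ 2] :: complex^2)"
        by (auto simp: proportional_iff)
      then have c: "c \<noteq> 0" "w $ 1 = c * z $ 1" "w $ 2 = c * z $ 2"
        by (auto simp: vec_eq_iff forall_2)
      have "(cmod (w $ 3))\<^sup>2 * (1 + 2 * a) = (cmod c)\<^sup>2 * ((cmod (z $ 3))\<^sup>2 * (1 + 2 * a))"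
      proof -
        have "(cmod (w $ 3))\<^sup>2 * (1 + 2 * a) = - 2 * a * ((cmod (w $ 1))\<^sup>2 + (cmod (w $ 2))\<^sup>2)"
          using level_coordinates[of w a] w pq by simp
        also have "\<dots> = (cmod c)\<^sup>2 * (- 2 * a * ((cmod (z $ 1))\<^sup>2 + (cmod (z $ 2))\<^sup>2))"
          by (simp add: c norm_mult power_mult_distrib algebra_simps)
        also have "- 2 * a * ((cmod (z $ 1))\<^sup>2 + (cmod (z $ 2))\<^sup>2) = (cmod (z $ 3))\<^sup>2 * (1 + 2 * a)"
          using level_coordinates[of z a] z pq by simp
        finally show ?thesis .
      qed
      then have "(cmod (w $ 3))\<^sup>2 = (cmod (c * z $ 3))\<^sup>2"
        using a by (simp add: norm_mult power_mult_distrib)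
      then have "cmod (w $ 3) = cmod (c * z $ 3)" by simp
      then obtain \<theta> where t: "w $ 3 = cis \<theta> * (c * z $ 3)"
      proof (cases "c * z $ 3 = 0")
        case False
        then have "cmod (w $ 3 / (c * z $ 3)) = 1"
          using \<open>cmod (w $ 3) = cmod (c * z $ 3)\<close> by (simp add: norm_divide)
        then obtain \<theta> where "w $ 3 / (c * z $ 3) = cis \<theta>"
          by (metis complex_norm_eq_1_exp cis_conv_exp)
        with False that[of \<theta>] show ?thesis by (simp add: field_simps)
      qed (use that[of 0] in auto)
      have n: "vector [z $ 1, z $ 2, cis \<theta> * z $ 3] \<noteq> (0 :: complex^3)"
        using zn by (auto simp: vec_eq_iff forall_3)
      have "w = c *s vector [z $ 1, z $ 2, cis \<theta> * z $ 3]"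
        by (simp add: vec_eq_iff forall_3 c t)
      then have "q = circle_act \<theta> p"
        using n c z w by (simp add: circle_act_proj proj_scale)
      then show "X = Y" by (simp add: pq orbit_circle_act)
    qed simp
  next
    fix y :: "2 cproj"
    obtain x where x: "x \<noteq> 0" "y = proj x" by (rule proj_cases)
    define n where "n = (cmod (x $ 1))\<^sup>2 + (cmod (x $ 2))\<^sup>2"
    have n: "n > 0"
      using x by (auto simp: n_def vec_eq_iff forall_2 intro: add_pos_nonneg add_nonneg_pos)
    define t where "t = - 2 * a / (1 + 2 * a) * n"
    have t: "t \<ge> 0" using a n by (simp add: t_def divide_nonpos_pos mult_nonpos_nonneg)
    define z :: "complex^3" where "z = vector [x $ 1, x $ 2, of_real (sqrt t)]"
    have zn: "z $ 1 \<noteq> 0 \<or> z $ 2 \<noteq> 0" using x by (auto simp: z_def vec_eq_iff forall_2)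
    then have z0: "z \<noteq> 0" by auto
    have tn: "n + t = n / (1 + 2 * a)"
      using a by (simp add: t_def field_simps)
    have "moment (proj z) = - (1/2) * (t / (n + t))"
      unfolding moment_proj[OF z0] using t by (simp add: z_def n_def)
    also have "\<dots> = a"
    proof -
      have "1 + 2 * a \<noteq> 0" using a by auto
      then have "t / (n / (1 + 2 * a)) = - 2 * a" using n by (simp add: t_def)
      then show ?thesis unfolding tn by simp
    qed
    finally have "orbit (proj z) \<in> reduced_space a"
      by (auto simp: reduced_space_def level_def)
    moreover have "vector [z $ 1, z $ 2] = x"
      by (simp add: z_def vec_eq_iff forall_2)
    then have "y = reduced_to_CP1 (orbit (proj z))"
      using x reduced_to_CP1_orbit[OF zn] by simp
    ultimately show "\<exists>X\<in>reduced_space a. y = reduced_to_CP1 X" by blast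
  qed simp
qed

text \<open>
  The reduced form $\omega_{red}$, determined by $\pi^*\omega_{red} = \iota^*\omega$, is
  \<open>1 + 2 * a\<close> times the Fubini-Study form of the projective line, hence of area $2\pi/3$ for
  $a = -1/6$.  Here \<open>u\<close> and \<open>v\<close> are tangent to the level set within the unit sphere.
\<close>

lemma reduced_fubini_study:
  fixes z u v :: "complex^3" and z' u' v' :: "complex^2" and j :: 3 and i :: 2
  defines "z' \<equiv> vector [z $ 1, z $ 2]"
    and "u' \<equiv> vector [u $ 1, u $ 2]" and "v' \<equiv> vector [v $ 1, v $ 2]"
    and "D \<equiv> frechet_derivative (\<lambda>y. (1 / y $ j) *s y) (at z)"
    and "D' \<equiv> frechet_derivative (\<lambda>y. (1 / y $ i) *s y) (at z')"
  assumes "norm z = 1" "moment (proj z) = a" "a < 0" "z $ j \<noteq> 0" "z' $ i \<noteq> 0"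
    and "z \<bullet> u = 0" "z \<bullet> v = 0" "z $ 3 \<bullet> u $ 3 = 0" "z $ 3 \<bullet> v $ 3 = 0"
  shows "fubini_study j (proj z) (D u) (D v) = (1 + 2 * a) * fubini_study i (proj z') (D' u') (D' v')"
proof -
  have nz: "(cmod (z $ 1))\<^sup>2 + (cmod (z $ 2))\<^sup>2 + (cmod (z $ 3))\<^sup>2 = 1"
    using \<open>norm z = 1\<close> by (simp add: norm_vec_def L2_set_def sum_3)
  have "z \<noteq> 0" using \<open>norm z = 1\<close> by auto
  then have a: "(cmod (z $ 3))\<^sup>2 = - 2 * a"
    using \<open>moment (proj z) = a\<close> nz by (simp add: moment_proj)
  have nz': "(norm z')\<^sup>2 = 1 + 2 * a"
    using nz a by (simp add: norm_vec_def L2_set_def sum_2 z'_def)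
  have "norm z' \<noteq> 0" using \<open>z' $ i \<noteq> 0\<close> by auto
  have "z' \<bullet> u' = 0" "z' \<bullet> v' = 0"
    using assms by (simp_all add: inner_vec_def sum_2 sum_3 z'_def u'_def v'_def)
  then have "fubini_study i (proj z') (D' u') (D' v') = std_form u' v' / (1 + 2 * a)"
    unfolding D'_def using fubini_study_pullback_scaled[of z' i u' v'] \<open>z' $ i \<noteq> 0\<close> nz' by simp
  moreover have "fubini_study j (proj z) (D u) (D v) = std_form u v"
    unfolding D_def using assms by (intro fubini_study_pullback) auto
  moreover have "std_form u v = std_form u' v'"
  proof -
    have "z $ 3 \<noteq> 0" using a \<open>a < 0\<close> by auto
    have "(cmod (z $ 3))\<^sup>2 * Im (cnj (u $ 3) * v $ 3) =
        (z $ 3 \<bullet> u $ 3) * Im (cnj (z $ 3) * v $ 3) - (z $ 3 \<bullet> v $ 3) * Im (cnj (z $ 3) * u $ 3)"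
      unfolding cmod_power2 inner_complex_def by (simp add: power2_eq_square algebra_simps)
    with assms \<open>z $ 3 \<noteq> 0\<close> have "Im (cnj (u $ 3) * v $ 3) = 0" by simp
    then show ?thesis
      by (simp add: std_form_def sum_2 sum_3 u'_def v'_def)
  qed
  ultimately show ?thesis
    using nz' \<open>norm z' \<noteq> 0\<close> by auto
qed


section \<open>Great circles in the projective line\<close>

text \<open>The geodesic distance of the Fubini-Study metric compatible with \<open>fubini_study\<close>.\<close>

lift_definition fs_dist :: "'n::finite cproj \<Rightarrow> 'n cproj \<Rightarrow> real"
  is "\<lambda>z w. arccos (cmod (\<Sum>j\<in>UNIV. cnj (z $ j) * w $ j) / (norm z * norm w))"
proof -
  fix z z' w w' :: "complex^'n"
  assume "proportional z z'" "proportional w w'"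
  then obtain c d where cd: "c \<noteq> 0" "d \<noteq> 0" "z' = c *s z" "w' = d *s w"
    by (auto simp: proportional_iff)
  have "(\<Sum>j\<in>UNIV. cnj (z' $ j) * w' $ j) = cnj c * d * (\<Sum>j\<in>UNIV. cnj (z $ j) * w $ j)"
    by (simp add: cd sum_distrib_left algebra_simps)
  then show "arccos (cmod (\<Sum>j\<in>UNIV. cnj (z $ j) * w $ j) / (norm z * norm w)) =
      arccos (cmod (\<Sum>j\<in>UNIV. cnj (z' $ j) * w' $ j) / (norm z' * norm w'))"
    using cd by (simp add: norm_mult norm_smult_complex)
qed

text \<open>
  The identification of the projective line with the round sphere.  With the metric \<open>fs_dist\<close>
  the projective line is a sphere of radius \<open>1/2\<close>; we scale it to the unit sphere.
\<close>

lift_definition to_sphere :: "2 cproj \<Rightarrow> real^3"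
  is "\<lambda>z. vector [2 * Re (cnj (z $ 1) * z $ 2), 2 * Im (cnj (z $ 1) * z $ 2),
                  (cmod (z $ 1))\<^sup>2 - (cmod (z $ 2))\<^sup>2] /\<^sub>R (norm z)\<^sup>2"
proof -
  fix z w :: "complex^2"
  assume "proportional z w"
  then obtain c where c: "c \<noteq> 0" "w = c *s z" by (auto simp: proportional_iff)
  have e: "cnj (c * z $ 1) * (c * z $ 2) = of_real ((cmod c)\<^sup>2) * (cnj (z $ 1) * z $ 2)"
    by (simp add: complex_norm_square del: of_real_power)
  have "vector [2 * Re (cnj (w $ 1) * w $ 2), 2 * Im (cnj (w $ 1) * w $ 2),
                  (cmod (w $ 1))\<^sup>2 - (cmod (w $ 2))\<^sup>2] =
     (cmod c)\<^sup>2 *\<^sub>R (vector [2 * Re (cnj (z $ 1) * z $ 2), 2 * Im (cnj (z $ 1) * z $ 2),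
                  (cmod (z $ 1))\<^sup>2 - (cmod (z $ 2))\<^sup>2] :: real^3)"
    unfolding c vector_smult_component e
    by (simp add: vec_eq_iff forall_3 norm_mult power_mult_distrib algebra_simps
        del: of_real_power complex_cnj_mult)
  then show "vector [2 * Re (cnj (z $ 1) * z $ 2), 2 * Im (cnj (z $ 1) * z $ 2),
                  (cmod (z $ 1))\<^sup>2 - (cmod (z $ 2))\<^sup>2] /\<^sub>R (norm z)\<^sup>2 =
     (vector [2 * Re (cnj (w $ 1) * w $ 2), 2 * Im (cnj (w $ 1) * w $ 2),
                  (cmod (w $ 1))\<^sup>2 - (cmod (w $ 2))\<^sup>2] /\<^sub>R (norm w)\<^sup>2 :: real^3)"
    using c by (simp add: norm_smult_complex power_mult_distrib)
qed

lemma to_sphere_proj: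
  "z \<noteq> 0 \<Longrightarrow> to_sphere (proj z) =
     vector [2 * Re (cnj (z $ 1) * z $ 2), 2 * Im (cnj (z $ 1) * z $ 2),
             (cmod (z $ 1))\<^sup>2 - (cmod (z $ 2))\<^sup>2] /\<^sub>R (norm z)\<^sup>2"
  unfolding proj_def
  by (subst to_sphere.abs_eq) (auto simp: proportional_iff intro!: exI[of _ 1])

lemma fs_dist_proj:
  "z \<noteq> 0 \<Longrightarrow> w \<noteq> 0 \<Longrightarrow> fs_dist (proj z) (proj w) =
     arccos (cmod (\<Sum>j\<in>UNIV. cnj (z $ j) * w $ j) / (norm z * norm w))"
  unfolding proj_def
  by (subst fs_dist.abs_eq) (auto simp: proportional_iff intro!: exI[of _ 1])

lemma fs_dist_refl: "fs_dist p p = 0"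
proof -
  obtain z where z: "z \<noteq> 0" "p = proj z" by (rule proj_cases)
  have "(\<Sum>j\<in>UNIV. cnj (z $ j) * z $ j) = of_real (z \<bullet> z)"
    by (simp add: inner_vec_def complex_eq_iff inner_complex_def)
  then have "cmod (\<Sum>j\<in>UNIV. cnj (z $ j) * z $ j) = norm z * norm z"
    by (simp add: dot_square_norm power2_eq_square norm_mult)
  then show ?thesis
    using z by (simp add: fs_dist_proj)
qed

lemma to_sphere_isometry: "to_sphere p \<bullet> to_sphere q = cos (2 * fs_dist p q)"
proof -
  obtain z where z: "z \<noteq> 0" "p = proj z" by (rule proj_cases)
  obtain w where w: "w \<noteq> 0" "q = proj w" by (rule proj_cases)
  define h where "h = cmod (\<Sum>j\<in>UNIV. cnj (z $ j) * w $ j)"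
  define N where "N = norm z * norm w"
  have N: "N > 0" using z w by (simp add: N_def)
  have N2: "N\<^sup>2 = ((cmod (z $ 1))\<^sup>2 + (cmod (z $ 2))\<^sup>2) * ((cmod (w $ 1))\<^sup>2 + (cmod (w $ 2))\<^sup>2)"
    by (simp add: N_def power_mult_distrib norm_vec_def L2_set_def sum_2)
  have h2: "h\<^sup>2 + (cmod (z $ 1 * w $ 2 - z $ 2 * w $ 1))\<^sup>2 = N\<^sup>2"
    unfolding N2 h_def sum_2 cmod_power2 by (simp add: power2_eq_square algebra_simps)
  then have "h\<^sup>2 \<le> N\<^sup>2" by (metis le_add_same_cancel1 zero_le_power2)
  then have "h \<le> N" using N by (simp add: power2_le_iff_abs_le)
  moreover have "h \<ge> 0" by (simp add: h_def)
  ultimately have "\<bar>h / N\<bar> \<le> 1" using N by simp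
  moreover have "fs_dist p q = arccos (h / N)"
    unfolding z w fs_dist_proj[OF z(1) w(1)] h_def N_def ..
  ultimately have "cos (fs_dist p q) = h / N"
    by (simp add: cos_arccos_abs)
  then have "cos (2 * fs_dist p q) = (2 * h\<^sup>2 - N\<^sup>2) / N\<^sup>2"
    using N by (simp add: cos_double_cos power_divide diff_divide_distrib)
  also have "2 * h\<^sup>2 - N\<^sup>2 =
     (2 * Re (cnj (z $ 1) * z $ 2)) * (2 * Re (cnj (w $ 1) * w $ 2)) +
     (2 * Im (cnj (z $ 1) * z $ 2)) * (2 * Im (cnj (w $ 1) * w $ 2)) +
     ((cmod (z $ 1))\<^sup>2 - (cmod (z $ 2))\<^sup>2) * ((cmod (w $ 1))\<^sup>2 - (cmod (w $ 2))\<^sup>2)"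
    unfolding N2 h_def sum_2 cmod_power2 by (simp add: power2_eq_square algebra_simps)
  also have "\<dots> / N\<^sup>2 = to_sphere p \<bullet> to_sphere q"
    unfolding z w to_sphere_proj[OF z(1)] to_sphere_proj[OF w(1)]
    by (simp add: inner_vec_def sum_3 N_def power_mult_distrib divide_inverse algebra_simps)
  finally show ?thesis by simp
qed

lemma bij_to_sphere: "bij_betw to_sphere UNIV (sphere 0 1)"
proof (rule bij_betwI')
  fix p q :: "2 cproj"
  show "to_sphere p = to_sphere q \<longleftrightarrow> p = q"
  proof
    assume eq: "to_sphere p = to_sphere q"
    obtain z where z: "z \<noteq> 0" "p = proj z" by (rule proj_cases)
    obtain w where w: "w \<noteq> 0" "q = proj w" by (rule proj_cases)
    define N where "N = (norm z)\<^sup>2 * (norm w)\<^sup>2"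
    have N: "N > 0" using z w by (simp add: N_def)
    have nz: "(norm z)\<^sup>2 = (cmod (z $ 1))\<^sup>2 + (cmod (z $ 2))\<^sup>2"
      and nw: "(norm w)\<^sup>2 = (cmod (w $ 1))\<^sup>2 + (cmod (w $ 2))\<^sup>2"
      by (simp_all add: norm_vec_def L2_set_def sum_2)
    have "1 = to_sphere p \<bullet> to_sphere q"
      by (simp add: eq to_sphere_isometry fs_dist_refl)
    also have "\<dots> = ((2 * Re (cnj (z $ 1) * z $ 2)) * (2 * Re (cnj (w $ 1) * w $ 2)) +
       (2 * Im (cnj (z $ 1) * z $ 2)) * (2 * Im (cnj (w $ 1) * w $ 2)) +
       ((cmod (z $ 1))\<^sup>2 - (cmod (z $ 2))\<^sup>2) * ((cmod (w $ 1))\<^sup>2 - (cmod (w $ 2))\<^sup>2)) / N"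
      unfolding z w to_sphere_proj[OF z(1)] to_sphere_proj[OF w(1)]
      by (simp add: inner_vec_def sum_3 N_def divide_inverse algebra_simps)
    finally have "N = (2 * Re (cnj (z $ 1) * z $ 2)) * (2 * Re (cnj (w $ 1) * w $ 2)) +
       (2 * Im (cnj (z $ 1) * z $ 2)) * (2 * Im (cnj (w $ 1) * w $ 2)) +
       ((cmod (z $ 1))\<^sup>2 - (cmod (z $ 2))\<^sup>2) * ((cmod (w $ 1))\<^sup>2 - (cmod (w $ 2))\<^sup>2)"
      using N by simp
    also have "\<dots> = N - 2 * (cmod (z $ 1 * w $ 2 - z $ 2 * w $ 1))\<^sup>2"
      unfolding N_def nz nw cmod_power2 by (simp add: power2_eq_square algebra_simps)
    finally have e: "z $ 1 * w $ 2 = z $ 2 * w $ 1" by simp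
    have "\<exists>c. w = c *s z"
    proof (cases "z $ 1 = 0")
      case True
      with z have "z $ 2 \<noteq> 0" by (auto simp: vec_eq_iff forall_2)
      with True e show ?thesis
        by (intro exI[of _ "w $ 2 / z $ 2"]) (simp add: vec_eq_iff forall_2)
    next
      case False
      with e show ?thesis
        by (intro exI[of _ "w $ 1 / z $ 1"]) (simp add: vec_eq_iff forall_2 field_simps)
    qed
    with z w have "proportional z w" by (simp add: proportional_def)
    with z w show "p = q" by (simp add: proj_eq_iff)
  qed simp
next
  fix p
  have "to_sphere p \<bullet> to_sphere p = 1"
    by (simp add: to_sphere_isometry fs_dist_refl)
  then show "to_sphere p \<in> sphere 0 1"
    by (simp add: norm_eq_1)
next
  fix x :: "real^3"
  assume "x \<in> sphere 0 1"
  then have x: "(x $ 1)\<^sup>2 + (x $ 2)\<^sup>2 + (x $ 3)\<^sup>2 = 1"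
    by (simp add: norm_vec_def L2_set_def sum_3)
  show "\<exists>p\<in>UNIV. x = to_sphere p"
  proof (cases "x $ 3 = -1")
    case True
    then have *: "x $ 1 = 0" "x $ 2 = 0" using x by (auto simp: sum_power2_eq_zero_iff)
    have "vector [0, 1] \<noteq> (0 :: complex^2)" by (auto simp: vec_eq_iff forall_2)
    then have "to_sphere (proj (vector [0, 1])) = x"
      using True * by (simp add: to_sphere_proj norm_vec_def L2_set_def sum_2 vec_eq_iff forall_3)
    then show ?thesis by blast
  next
    case False
    define c where "c = 1 + x $ 3"
    have c: "c \<noteq> 0" using False by (simp add: c_def)
    define z :: "complex^2" where "z = vector [of_real c, Complex (x $ 1) (x $ 2)]"
    have z: "z \<noteq> 0" using c by (auto simp: z_def vec_eq_iff forall_2)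
    have s: "(x $ 1)\<^sup>2 + (x $ 2)\<^sup>2 = c * (2 - c)"
      using x by (simp add: c_def power2_eq_square algebra_simps)
    have n: "(norm z)\<^sup>2 = 2 * c"
    proof -
      have "(norm z)\<^sup>2 = (cmod (z $ 1))\<^sup>2 + (cmod (z $ 2))\<^sup>2"
        by (simp add: norm_vec_def L2_set_def sum_2)
      also have "\<dots> = 2 * c"
        using s by (simp add: z_def cmod_power2) (simp add: power2_eq_square algebra_simps)
      finally show ?thesis .
    qed
    have d: "(cmod (z $ 1))\<^sup>2 - (cmod (z $ 2))\<^sup>2 = 2 * c * (c - 1)"
      using s by (simp add: z_def cmod_power2) (simp add: power2_eq_square algebra_simps)
    have "to_sphere (proj z) = x"
      unfolding to_sphere_proj[OF z] n d
      using c by (simp add: vec_eq_iff forall_3 z_def) (simp add: c_def)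
    then show ?thesis by blast
  qed
qed

text \<open>Great circles are the intersections of the sphere with the planes through its centre.\<close>

definition great_circle :: "2 cproj set \<Rightarrow> bool" where
  "great_circle C \<longleftrightarrow> (\<exists>n. n \<noteq> 0 \<and> C = {p. n \<bullet> to_sphere p = 0})"


section \<open>The submanifold $\mathcal{L}_2$\<close>

definition L2 :: "3 cproj set" where
  "L2 = {proj (vector [(cnj \<alpha>)\<^sup>2 + (cnj \<beta>)\<^sup>2,
                       of_real (sqrt 2) * (cnj \<alpha> * \<beta> - \<alpha> * cnj \<beta>),
                       \<alpha>\<^sup>2 + \<beta>\<^sup>2]) |\<alpha> \<beta>. (cmod \<alpha>)\<^sup>2 + (cmod \<beta>)\<^sup>2 = 1}"

lemma L2_coordinates_nonzero:
  assumes "(cmod \<alpha>)\<^sup>2 + (cmod \<beta>)\<^sup>2 = 1"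
  shows "vector [(cnj \<alpha>)\<^sup>2 + (cnj \<beta>)\<^sup>2, of_real (sqrt 2) * (cnj \<alpha> * \<beta> - \<alpha> * cnj \<beta>), \<alpha>\<^sup>2 + \<beta>\<^sup>2]
           \<noteq> (0 :: complex^3)"
proof
  assume "vector [(cnj \<alpha>)\<^sup>2 + (cnj \<beta>)\<^sup>2, of_real (sqrt 2) * (cnj \<alpha> * \<beta> - \<alpha> * cnj \<beta>), \<alpha>\<^sup>2 + \<beta>\<^sup>2]
           = (0 :: complex^3)"
  then have "cnj \<alpha> * \<beta> = \<alpha> * cnj \<beta>" "\<alpha>\<^sup>2 + \<beta>\<^sup>2 = 0"
    by (auto simp: vec_eq_iff forall_3)
  then have "\<alpha> * ((cnj \<alpha> * \<alpha>) + (cnj \<beta> * \<beta>)) = 0"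
    by (simp add: power2_eq_square) algebra
  moreover have "(cnj \<alpha> * \<alpha>) + (cnj \<beta> * \<beta>) = 1"
    using assms by (metis complex_norm_square mult.commute of_real_1 of_real_add)
  ultimately have "\<alpha> = 0" by simp
  with \<open>\<alpha>\<^sup>2 + \<beta>\<^sup>2 = 0\<close> assms show False by simp
qed

end

(*
  For |a|^2 + |b|^2 = 1 the vector (a^2 + b^2, 2 Im(cnj a b)) runs over the whole unit sphere of
  C x R, so L2 is the projectivization of the real three-dimensional subspace
  V2 = {(cnj w, i s, w)} of C^3, a unitary image of R^3.  Since the standard symplectic form vanishes
  on V2, the Hermitian product with a fixed vector of V2 is real on V2.  Dividing by it instead of by
  a coordinate flattens L2, and identifies its tangent vectors with vectors of V2, on which
  the Fubini-Study form vanishes.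

  On the level set -1/6, that is 2 |z_2|^2 = |z_0|^2 + |z_1|^2, the points of L2 are the
  [cnj w : i : w] with |w| = 1.  Their orbits are the points [cnj w : i] of the projective line, which
  are distinct and make up the equator |z_0| = |z_1|.  Transversality holds because C^3 is spanned
  by V2, the complex line of z and the vectors (c z_0, - Re c z_1, 0) tangent to the level set.
*)
theory Submission
  imports Defs
begin

section \<open>Calculus of smooth maps\<close>

text \<open>As \<open>frechet_derivative\<close> at a point of an open set sees only values nearby,
  agreement on \<open>S\<close> passes to all derivatives.\<close>

lemma ck_on_cong:
  assumes "open S" "\<And>x. x \<in> S \<Longrightarrow> f x = g x" "ck_on k S f"
  shows "ck_on k S g"
  using assms(2,3)
proof (induction k arbitrary: f g)
  case 0
  then show ?case by (metis ck_on.simps(1) continuous_on_cong)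
next
  case (Suc k)
  have g: "(g has_derivative frechet_derivative f (at x)) (at x)" if "x \<in> S" for x
  proof -
    have "(f has_derivative frechet_derivative f (at x)) (at x)"
      using Suc.prems that by (simp flip: frechet_derivative_works)
    then show ?thesis
      using has_derivative_transform_within_open[of f _ x UNIV S g] assms(1) that Suc.prems(1) by auto
  qed
  then have "frechet_derivative g (at x) = frechet_derivative f (at x)" if "x \<in> S" for x
    using frechet_derivative_at that by metis
  then show ?case
    using Suc.IH[of "\<lambda>x. frechet_derivative f (at x) v" "\<lambda>x. frechet_derivative g (at x) v" for v]
      Suc.prems(2) g by (auto intro: differentiableI)
qed

text \<open>Allows an explicit derivative \<open>f'\<close> in place of
  \<open>frechet_derivative\<close>, so that the differentiation rules can drive the inductions that
  follow.\<close>

lemma ck_on_SucI: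
  assumes "open S" "\<And>x. x \<in> S \<Longrightarrow> (f has_derivative f' x) (at x)" "\<And>v. ck_on k S (\<lambda>x. f' x v)"
  shows "ck_on (Suc k) S f"
proof -
  have "frechet_derivative f (at x) = f' x" if "x \<in> S" for x
    using frechet_derivative_at assms(2) that by metis
  then have "ck_on k S (\<lambda>x. frechet_derivative f (at x) v)" for v
    by (intro ck_on_cong[OF assms(1) _ assms(3)]) simp
  then show ?thesis
    using assms(2) by (auto simp: differentiable_def)
qed

lemma ck_on_SucD:
  assumes "ck_on (Suc k) S f"
  shows "x \<in> S \<Longrightarrow> (f has_derivative frechet_derivative f (at x)) (at x)"
    and "ck_on k S (\<lambda>x. frechet_derivative f (at x) v)"
    and "ck_on k S f"
proof -
  show "x \<in> S \<Longrightarrow> (f has_derivative frechet_derivative f (at x)) (at x)"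
    and "ck_on k S (\<lambda>x. frechet_derivative f (at x) v)"
    using assms by (auto simp flip: frechet_derivative_works)
  show "ck_on k S f"
    using assms
  proof (induction k arbitrary: f)
    case 0
    then show ?case
      by (auto intro!: continuous_at_imp_continuous_on differentiable_imp_continuous_within)
  next
    case (Suc k)
    then show ?case by (metis ck_on.simps(2))
  qed
qed

lemma ck_on_subset: "ck_on k S f \<Longrightarrow> T \<subseteq> S \<Longrightarrow> ck_on k T f"
  by (induction k arbitrary: f) (auto intro: continuous_on_subset)

lemma ck_on_const:
  assumes "open S"
  shows "ck_on k S (\<lambda>x. c)"
proof (induction k arbitrary: c)
  case (Suc k)
  then show ?case
    by (intro ck_on_SucI[OF assms, where f' = "\<lambda>x v. 0"]) auto
qed simp

lemma ck_on_bounded_linear: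
  assumes "open S" "bounded_linear f"
  shows "ck_on k S f"
proof (cases k)
  case 0
  then show ?thesis using assms by (simp add: linear_continuous_on)
next
  case (Suc m)
  show ?thesis
    unfolding Suc using assms
    by (intro ck_on_SucI[where f' = "\<lambda>x. f"]) (auto intro: bounded_linear_imp_has_derivative ck_on_const)
qed

lemma ck_on_bounded_linear_compose:
  assumes "open S" "bounded_linear h" "ck_on k S f"
  shows "ck_on k S (\<lambda>x. h (f x))"
  using assms(3)
proof (induction k arbitrary: f)
  case 0
  then show ?case by (simp add: bounded_linear.continuous_on[OF assms(2)])
next
  case (Suc k)
  note f = ck_on_SucD[OF Suc.prems]
  show ?case
    by (intro ck_on_SucI[OF assms(1) bounded_linear.has_derivative[OF assms(2) f(1)]] Suc.IH f(2))
qed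

lemma ck_on_add:
  assumes "open S" "ck_on k S f" "ck_on k S g"
  shows "ck_on k S (\<lambda>x. f x + g x)"
  using assms(2,3)
proof (induction k arbitrary: f g)
  case 0
  then show ?case by (simp add: continuous_on_add)
next
  case (Suc k)
  note f = ck_on_SucD[OF Suc.prems(1)] and g = ck_on_SucD[OF Suc.prems(2)]
  show ?case
    by (intro ck_on_SucI[OF assms(1) has_derivative_add[OF f(1) g(1)]] Suc.IH[OF f(2) g(2)])
qed

text \<open>By the Leibniz rule the derivative is a sum of two terms \<open>B\<close>, each with one
  factor differentiated, to which the induction hypothesis applies.\<close>

lemma ck_on_bounded_bilinear:
  assumes "open S" "bounded_bilinear B" "ck_on k S f" "ck_on k S g"
  shows "ck_on k S (\<lambda>x. B (f x) (g x))"
  using assms(3,4)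
proof (induction k arbitrary: f g)
  case 0
  then show ?case by (simp add: bounded_bilinear.continuous_on[OF assms(2)])
next
  case (Suc k)
  note f = ck_on_SucD[OF Suc.prems(1)] and g = ck_on_SucD[OF Suc.prems(2)]
  show ?case
    by (intro ck_on_SucI[OF assms(1) bounded_bilinear.FDERIV[OF assms(2) f(1) g(1)]]
        ck_on_add[OF assms(1)] Suc.IH f g)
qed

text \<open>The derivative \<open>- (1/f) f' (1/f)\<close> involves the inverse itself only to one
  order less, which the induction supplies.\<close>

lemma ck_on_inverse:
  fixes f :: "'a::euclidean_space \<Rightarrow> 'b::{euclidean_space,real_normed_div_algebra}"
  assumes "open S" "ck_on k S f" "\<And>x. x \<in> S \<Longrightarrow> f x \<noteq> 0"
  shows "ck_on k S (\<lambda>x. inverse (f x))"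
  using assms(2)
proof (induction k)
  case 0
  then show ?case using assms(3) by (auto intro: continuous_on_inverse)
next
  case (Suc k)
  note f = ck_on_SucD[OF Suc.prems]
  have inv: "ck_on k S (\<lambda>x. inverse (f x))" using Suc.IH f(3) .
  have minus: "ck_on k S (\<lambda>x. - g x)" if "ck_on k S g" for g :: "'a \<Rightarrow> 'b"
    using ck_on_bounded_bilinear[OF assms(1) bounded_bilinear_mult ck_on_const[OF assms(1), of k "- 1"] that]
    by simp
  show ?case
    by (intro ck_on_SucI[OF assms(1) Deriv.has_derivative_inverse[OF assms(3) f(1)]] minus
        ck_on_bounded_bilinear[OF assms(1) bounded_bilinear_mult] inv f(2))
qed

lemma smooth_on_subset: "smooth_on S f \<Longrightarrow> open T \<Longrightarrow> T \<subseteq> S \<Longrightarrow> smooth_on T f"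
  unfolding smooth_on_def using ck_on_subset by blast

lemma smooth_on_const: "open S \<Longrightarrow> smooth_on S (\<lambda>x. c)"
  by (simp add: smooth_on_def ck_on_const)

lemma smooth_on_bounded_linear: "open S \<Longrightarrow> bounded_linear f \<Longrightarrow> smooth_on S f"
  by (simp add: smooth_on_def ck_on_bounded_linear)

lemma smooth_on_bounded_linear_compose:
  "bounded_linear h \<Longrightarrow> smooth_on S f \<Longrightarrow> smooth_on S (\<lambda>x. h (f x))"
  by (simp add: smooth_on_def ck_on_bounded_linear_compose)

lemma smooth_on_add: "smooth_on S f \<Longrightarrow> smooth_on S g \<Longrightarrow> smooth_on S (\<lambda>x. f x + g x)"
  by (simp add: smooth_on_def ck_on_add)

lemma smooth_on_bounded_bilinear:
  "bounded_bilinear B \<Longrightarrow> smooth_on S f \<Longrightarrow> smooth_on S g \<Longrightarrow> smooth_on S (\<lambda>x. B (f x) (g x))"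
  by (simp add: smooth_on_def ck_on_bounded_bilinear)

lemmas smooth_on_mult = smooth_on_bounded_bilinear[OF bounded_bilinear_mult]
lemmas smooth_on_smult = smooth_on_bounded_bilinear[OF bounded_bilinear_smult]

lemma smooth_on_inverse:
  fixes f :: "'a::euclidean_space \<Rightarrow> 'b::{euclidean_space,real_normed_div_algebra}"
  shows "smooth_on S f \<Longrightarrow> (\<And>x. x \<in> S \<Longrightarrow> f x \<noteq> 0) \<Longrightarrow> smooth_on S (\<lambda>x. inverse (f x))"
  by (simp add: smooth_on_def ck_on_inverse)


section \<open>Tangent vectors in homogeneous coordinates\<close>

text \<open>A point in the domain of the chart has only representatives with nonzero
  \<open>j\<close>th coordinate. The value of \<open>proj 0\<close> is unspecified, hence
  \<open>0\<close> is kept out of \<open>A\<close>.\<close>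

lemma chart_image_proj:
  assumes "0 \<notin> A"
  shows "chart j ` (proj ` A \<inter> chart_dom j) = (\<lambda>z. (1 / z $ j) *s z) ` {z \<in> A. z $ j \<noteq> 0}"
proof -
  have "z $ j \<noteq> 0" if "z \<in> A" "proj z \<in> chart_dom j" for z
  proof -
    from that obtain x where "x $ j = 1" "proj z = proj x" by (auto simp: chart_dom_def)
    moreover from this have "x \<noteq> 0" by auto
    moreover have "z \<noteq> 0" using that assms by auto
    ultimately show ?thesis by (auto simp: proj_eq_iff proportional_def)
  qed
  then show ?thesis by (force simp: chart_proj image_iff)
qed

lemma chart_nth: "p \<in> chart_dom j \<Longrightarrow> chart j p $ j = 1"
  by (auto simp: chart_dom_def chart_proj)

text \<open>The derivative of \<open>y \<mapsto> (1 / y $ j) *s y\<close> at \<open>z\<close>; its kernel is the complex line of \<open>z\<close>.\<close>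

definition dchart :: "'n \<Rightarrow> complex^'n \<Rightarrow> complex^'n \<Rightarrow> complex^'n" where
  "dchart j z u = (1 / z $ j) *s (u - (u $ j / z $ j) *s z)"

lemma has_derivative_dchart:
  "z $ j \<noteq> 0 \<Longrightarrow> ((\<lambda>y. (1 / y $ j) *s y) has_derivative dchart j z) (at z)"
  unfolding dchart_def by (rule has_derivative_chart)

lemma fubini_study_dchart:
  assumes "z $ j \<noteq> 0" "z \<bullet> u = 0" "z \<bullet> v = 0"
  shows "fubini_study j (proj z) (dchart j z u) (dchart j z v) = std_form u v / (norm z)\<^sup>2"
  using fubini_study_pullback_scaled[OF assms] frechet_derivative_at[OF has_derivative_dchart[OF assms(1)]]
  by simp

lemma dchart_add: "dchart j z (u + v) = dchart j z u + dchart j z v"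
  by (simp add: dchart_def vec_eq_iff algebra_simps add_divide_distrib)

lemma dchart_smult_self: "z $ j \<noteq> 0 \<Longrightarrow> dchart j z (c *s z) = 0"
  by (simp add: dchart_def vec_eq_iff)

text \<open>Provides the lift of a coordinate vector to homogeneous coordinates.\<close>

lemma dchart_smult_chart: "z $ j \<noteq> 0 \<Longrightarrow> \<xi> $ j = 0 \<Longrightarrow> dchart j z (z $ j *s \<xi>) = \<xi>"
  by (simp add: dchart_def vec_eq_iff)

text \<open>Curves in the chart stay in the hyperplane \<open>x $ j = 1\<close>, so their
  \<open>j\<close>th coordinate is constant.\<close>

lemma tangent_nth:
  assumes "\<xi> \<in> tangent j L p"
  shows "\<xi> $ j = 0"
proof -
  obtain c e where c: "e > 0" "c ` {-e<..<e} \<subseteq> chart j ` (L \<inter> chart_dom j)"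
    "(c has_vector_derivative \<xi>) (at 0)"
    using assms unfolding tangent_def tangent_vectors_def by blast
  have "((\<lambda>t. c t $ j) has_vector_derivative \<xi> $ j) (at 0)"
    by (rule bounded_linear.has_vector_derivative[OF bounded_linear_vec_nth c(3)])
  moreover have const: "c t $ j = 1" if "t \<in> {-e<..<e}" for t
  proof -
    have "c t \<in> chart j ` (L \<inter> chart_dom j)" using c(2) that by blast
    then show ?thesis using chart_nth by fastforce
  qed
  have "((\<lambda>t. c t $ j) has_vector_derivative 0) (at 0)"
    by (rule has_vector_derivative_transform_within_open[where f = "\<lambda>t. 1" and S = "{-e<..<e}"])
      (use c(1) const in auto)
  ultimately show ?thesis by (rule vector_derivative_unique_at)
qed

text \<open>Yields tangent vectors from curves in homogeneous coordinates. Such a curve may vanish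
  or leave the chart far from \<open>0\<close>, so it is cut down to an interval on which its
  \<open>j\<close>th coordinate is nonzero.\<close>

lemma dchart_in_tangent:
  assumes "smooth_on UNIV \<gamma>" "\<gamma> 0 = z" "(\<gamma> has_vector_derivative u) (at 0)" "z $ j \<noteq> 0"
    and L: "\<And>t. \<gamma> t \<noteq> 0 \<Longrightarrow> proj (\<gamma> t) \<in> L"
  shows "dchart j z u \<in> tangent j L (proj z)"
proof -
  have "continuous (at 0) (\<lambda>t. \<gamma> t $ j)"
    using has_vector_derivative_continuous[OF assms(3)] by (intro continuous_intros)
  then have "eventually (\<lambda>t. \<gamma> t $ j \<noteq> 0) (at 0)"
    using assms(2,4) by (simp add: isCont_def tendsto_imp_eventually_ne)
  then obtain e where e: "e > 0" "\<And>t. t \<noteq> 0 \<Longrightarrow> \<bar>t\<bar> < e \<Longrightarrow> \<gamma> t $ j \<noteq> 0"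
    by (auto simp: eventually_at dist_real_def)
  have nz: "\<gamma> t $ j \<noteq> 0" if "t \<in> {-e<..<e}" for t
    using e(2)[of t] that assms(2,4) by (cases "t = 0") (auto simp: abs_less_iff)
  let ?c = "\<lambda>t. inverse (\<gamma> t $ j) *s \<gamma> t"
  have \<gamma>: "smooth_on {-e<..<e} \<gamma>" using assms(1) by (rule smooth_on_subset) auto
  have "smooth_on {-e<..<e} (\<lambda>t. \<gamma> t $ j)"
    by (intro smooth_on_bounded_linear_compose[OF bounded_linear_vec_nth] \<gamma>)
  then have "smooth_on {-e<..<e} ?c"
    using nz by (intro smooth_on_smult smooth_on_inverse \<gamma>) auto
  moreover have "?c t \<in> chart j ` (L \<inter> chart_dom j)" if "t \<in> {-e<..<e}" for t
  proof -
    have "\<gamma> t \<noteq> 0" using nz[OF that] by auto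
    then show ?thesis
      using L[of t] chart_proj[of "\<gamma> t" j] nz[OF that]
      by (intro image_eqI[of _ _ "proj (\<gamma> t)"]) (auto simp: inverse_eq_divide)
  qed
  moreover have "(?c has_vector_derivative dchart j z u) (at 0)"
  proof -
    have "((\<lambda>t. (1 / \<gamma> t $ j) *s \<gamma> t) has_derivative (\<lambda>t. dchart j z (t *\<^sub>R u))) (at 0)"
      using has_derivative_compose[of \<gamma> "\<lambda>t. t *\<^sub>R u" 0 UNIV "\<lambda>y. (1 / y $ j) *s y" "dchart j z"]
        assms(2,3) has_derivative_dchart[OF assms(4)] by (simp add: has_vector_derivative_def)
    moreover have "dchart j z (t *\<^sub>R u) = t *\<^sub>R dchart j z u" for t
      by (simp add: dchart_def vec_eq_iff scaleR_conv_of_real[where 'a = complex] field_simps)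
    ultimately show ?thesis
      by (simp add: has_vector_derivative_def inverse_eq_divide)
  qed
  ultimately show ?thesis
    unfolding tangent_def tangent_vectors_def using e(1) assms(2,4)
    by (auto simp: chart_proj inverse_eq_divide intro!: exI[of _ ?c] exI[of _ e])
qed

lemma dchart_line_in_tangent:
  assumes "z $ j \<noteq> 0" "\<And>t. z + t *\<^sub>R u \<noteq> 0 \<Longrightarrow> proj (z + t *\<^sub>R u) \<in> L"
  shows "dchart j z u \<in> tangent j L (proj z)"
proof (rule dchart_in_tangent)
  show "smooth_on UNIV (\<lambda>t. z + t *\<^sub>R u)"
    by (intro smooth_on_add smooth_on_const smooth_on_bounded_linear bounded_linear_scaleR_left) auto
  show "((\<lambda>t. z + t *\<^sub>R u) has_vector_derivative u) (at 0)"
    by (auto intro!: derivative_eq_intros)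
qed (use assms in auto)

lemma tangent_UNIV:
  assumes "z $ j \<noteq> 0"
  shows "tangent j UNIV (proj z) = {\<xi>. \<xi> $ j = 0}"
proof
  show "{\<xi>. \<xi> $ j = 0} \<subseteq> tangent j UNIV (proj z)"
  proof
    fix \<xi> :: "complex^'a" assume "\<xi> \<in> {\<xi>. \<xi> $ j = 0}"
    then show "\<xi> \<in> tangent j UNIV (proj z)"
      using dchart_line_in_tangent[of z j "z $ j *s \<xi>" UNIV] assms by (simp add: dchart_smult_chart)
  qed
qed (use tangent_nth in blast)


section \<open>Real lagrangian subspaces\<close>

definition hprod :: "complex^'n \<Rightarrow> complex^'n \<Rightarrow> complex" where
  "hprod u z = (\<Sum>i\<in>UNIV. cnj (u $ i) * z $ i)"

text \<open>The link between symplectic and Hermitian geometry: where \<open>std_form\<close>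
  vanishes, Hermitian products are real.\<close>

lemma hprod_eq: "hprod u z = Complex (u \<bullet> z) (std_form u z)"
  by (simp add: hprod_def std_form_def inner_vec_def inner_complex_def complex_eq_iff)

lemma hprod_smult: "hprod u (c *s z) = c * hprod u z"
  by (simp add: hprod_def sum_distrib_left algebra_simps)

lemma bounded_linear_hprod: "bounded_linear (hprod u)"
  unfolding linear_conv_bounded_linear[symmetric]
  by (rule linearI) (simp_all add: hprod_def algebra_simps sum.distrib scaleR_sum_right)

lemma hprod_diff: "hprod u (x - y) = hprod u x - hprod u y"
  by (rule linear_diff) (simp add: linear_conv_bounded_linear bounded_linear_hprod)

lemma of_real_smult: "of_real r *s z = r *\<^sub>R z" for z :: "complex^'n"
  by (simp add: vec_eq_iff scaleR_conv_of_real[where 'a = complex])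

text \<open>Pairing with any \<open>y\<close> orthogonal to \<open>V\<close> gives a function that
  is zero near \<open>t\<close>, so \<open>u\<close> lies in the double orthogonal complement of
  \<open>V\<close>.\<close>

lemma has_vector_derivative_in_subspace:
  fixes V :: "'a::euclidean_space set"
  assumes "(f has_vector_derivative u) (at t)" "subspace V" "e > 0" "\<And>s. \<bar>s - t\<bar> < e \<Longrightarrow> f s \<in> V"
  shows "u \<in> V"
proof -
  have "orthogonal y u" if "y \<in> orthogonal_comp V" for y
  proof -
    have "((\<lambda>s. y \<bullet> f s) has_vector_derivative y \<bullet> u) (at t)"
      by (rule bounded_linear.has_vector_derivative[OF bounded_linear_inner_right assms(1)])
    moreover have const: "y \<bullet> f s = 0" if "s \<in> ball t e" for s
      using \<open>y \<in> orthogonal_comp V\<close> assms(4)[of s] that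
      by (auto simp: orthogonal_comp_def orthogonal_def dist_real_def inner_commute abs_minus_commute)
    have "((\<lambda>s. y \<bullet> f s) has_vector_derivative 0) (at t)"
      by (rule has_vector_derivative_transform_within_open[where f = "\<lambda>s. 0" and S = "ball t e"])
        (use assms(3) const in auto)
    ultimately show ?thesis
      unfolding orthogonal_def by (rule vector_derivative_unique_at)
  qed
  then have "u \<in> orthogonal_comp (orthogonal_comp V)"
    by (simp add: orthogonal_comp_def)
  then show ?thesis by (simp add: orthogonal_comp_self assms(2))
qed

text \<open>Here \<open>dim\<close> is the real dimension, so \<open>V\<close> has half the
  dimension of \<open>complex^'n\<close>.\<close>

locale lagrangian_subspace =
  fixes V :: "(complex^'n) set"
  assumes subspace: "subspace V"
    and dim: "dim V = CARD('n)"
    and isotropic: "\<And>u v. u \<in> V \<Longrightarrow> v \<in> V \<Longrightarrow> std_form u v = 0"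
begin

definition PV where "PV = proj ` (V - {0})"

lemma hprod_real: "u \<in> V \<Longrightarrow> v \<in> V \<Longrightarrow> hprod u v = of_real (u \<bullet> v)"
  by (simp add: hprod_eq isotropic complex_of_real_def)

lemma chart_image: "chart j ` (PV \<inter> chart_dom j) = (\<lambda>z. (1 / z $ j) *s z) ` {z \<in> V. z $ j \<noteq> 0}"
  unfolding PV_def by (subst chart_image_proj) auto

text \<open>If \<open>hprod u x = 0\<close>, the vector on the left is \<open>0\<close>.\<close>

lemma normalized_in_V:
  assumes "x \<in> chart j ` (PV \<inter> chart_dom j)" "u \<in> V"
  shows "inverse (hprod u x) *s x \<in> V"
proof -
  obtain z where z: "z \<in> V" "z $ j \<noteq> 0" "x = (1 / z $ j) *s z"
    using assms(1) by (auto simp: chart_image)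
  \<comment> \<open>The complex factor \<open>1 / z $ j\<close> cancels; what remains is real
    because \<open>u\<close> and \<open>z\<close> both lie in \<open>V\<close>.\<close>
  then have "inverse (hprod u x) *s x = inverse (u \<bullet> z) *\<^sub>R z"
    using hprod_real[OF assms(2) z(1)]
    by (simp add: hprod_smult inverse_eq_divide flip: of_real_smult)
  then show ?thesis using subspace z(1) by (simp add: subspace_mul)
qed

lemma smooth_submanifold_chart: "smooth_submanifold (CARD('n) - 1) (chart j ` (PV \<inter> chart_dom j))"
  unfolding smooth_submanifold_def
proof
  let ?S = "chart j ` (PV \<inter> chart_dom j)"
  fix x assume "x \<in> ?S"
  then obtain u where u: "u \<in> V" "u $ j \<noteq> 0" "x = (1 / u $ j) *s u"
    by (auto simp: chart_image)
  then have "u \<noteq> 0" by auto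
  let ?l = "hprod u"
  \<comment> \<open>Translation by \<open>-v\<close> moves the affine subspace
    \<open>u \<bullet> y = 1\<close> of \<open>V\<close> to the linear subspace \<open>K\<close>, as
    flattening demands.\<close>
  define v where "v = u /\<^sub>R (norm u)\<^sup>2"
  have v: "v \<in> V" "u \<bullet> v = 1"
    using u(1) \<open>u \<noteq> 0\<close> subspace by (auto simp: v_def subspace_mul power2_norm_eq_inner)
  define N where "N = {x. x $ j \<noteq> 0 \<and> ?l x \<noteq> 0}"
  \<comment> \<open>On the hyperplane \<open>x $ j = 1\<close> the map \<open>F\<close> is \<open>x \<mapsto> x / ?l x\<close>, which sends the chart image of \<open>PV\<close>
    to an affine subspace of \<open>V\<close>.  The homogeneous factor \<open>x $ j\<close> extends it to an open set
    with inverse \<open>G\<close>.\<close>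
  define F G where "F = (\<lambda>x. (x $ j * inverse (?l x)) *s x)" and "G = (\<lambda>x. (?l x * inverse (x $ j)) *s x)"
  define K where "K = {y \<in> V. u \<bullet> y = 0}"
  \<comment> \<open>The ratio of \<open>x $ j\<close> and \<open>?l x\<close> does not change when
    \<open>x\<close> is rescaled, so the factors in \<open>F\<close> and \<open>G\<close> are
    reciprocal.\<close>
  have F: "F x \<in> N" "G (F x) = x" if "x \<in> N" for x
    using that by (auto simp: N_def F_def G_def hprod_smult divide_simps)
  have G: "G x \<in> N" "F (G x) = x" if "x \<in> N" for x
    using that by (auto simp: N_def F_def G_def hprod_smult divide_simps)
  have smooth_nth: "smooth_on M (\<lambda>x. x $ j)" and smooth_l: "smooth_on M ?l" and smooth_id: "smooth_on M (\<lambda>x. x)"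
    if "open M" for M :: "(complex^'n) set"
    using that by (auto intro!: smooth_on_bounded_linear bounded_linear_vec_nth bounded_linear_hprod)
  have "open N"
    unfolding N_def
    by (intro open_Collect_conj open_Collect_neq continuous_intros linear_continuous_on bounded_linear_hprod)
  let ?N' = "{y. y + v \<in> N}"
  have "open ?N'"
    using continuous_open_vimage[OF \<open>open N\<close>, of "\<lambda>y. y + v"] by (simp add: vimage_def)
  have diffeo: "smooth_diffeo N ?N' (\<lambda>x. F x - v)"
    unfolding smooth_diffeo_def
  proof (intro conjI exI[of _ "\<lambda>y. G (y + v)"] ballI)
    show "smooth_on N (\<lambda>x. F x - v)"
      using \<open>open N\<close> smooth_nth smooth_l smooth_id smooth_on_const[of N "- v"] unfolding F_def diff_conv_add_uminus
      by (intro smooth_on_add smooth_on_smult smooth_on_mult smooth_on_inverse) (auto simp: N_def)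
    have shift: "smooth_on ?N' (\<lambda>y. y + v)"
      using \<open>open ?N'\<close> by (intro smooth_on_add smooth_id smooth_on_const)
    have "smooth_on ?N' (\<lambda>y. ?l y + ?l v)" "smooth_on ?N' (\<lambda>y. y $ j + v $ j)"
      using \<open>open ?N'\<close> smooth_l smooth_nth by (auto intro!: smooth_on_add smooth_on_const)
    moreover have "?l (y + v) = ?l y + ?l v" for y
      by (rule linear_add) (simp add: linear_conv_bounded_linear bounded_linear_hprod)
    ultimately show "smooth_on ?N' (\<lambda>y. G (y + v))"
      using shift unfolding G_def
      by (intro smooth_on_smult smooth_on_mult smooth_on_inverse) (auto simp: N_def)
    show "(\<lambda>x. F x - v) ` N = ?N'"
    proof (intro set_eqI iffI)
      fix y assume "y \<in> ?N'"
      then show "y \<in> (\<lambda>x. F x - v) ` N"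
        using G[of "y + v"] by (intro image_eqI[of _ _ "G (y + v)"]) auto
    qed (use F in auto)
  qed (use F in auto)
  have K: "subspace K"
    using subspace unfolding K_def subspace_def by (auto simp: inner_add_right)
  have "dim {y \<in> V. \<forall>x\<in>span {u}. orthogonal x y} + dim (span {u}) = dim V"
    using u(1) subspace by (intro dim_subspace_orthogonal_to_vectors) (auto simp: span_minimal)
  moreover have "{y \<in> V. \<forall>x\<in>span {u}. orthogonal x y} = K"
    by (auto simp: K_def orthogonal_def span_singleton intro: exI[of _ 1])
  ultimately have "dim K = CARD('n) - 1"
    using \<open>u \<noteq> 0\<close> by (simp add: dim dim_insert)
  moreover have "(\<lambda>x. F x - v) ` (?S \<inter> N) = K \<inter> ?N'"
  proof (intro set_eqI iffI)
    fix y assume "y \<in> (\<lambda>x. F x - v) ` (?S \<inter> N)"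
    then obtain x where x: "x \<in> ?S" "x \<in> N" "y = F x - v" by auto
    then have "x $ j = 1" using chart_nth by auto
    then have Fx: "F x = inverse (?l x) *s x" by (simp add: F_def)
    then have "F x \<in> V" using normalized_in_V[OF x(1) u(1)] by simp
    moreover have "?l (F x) = 1" using x(2) by (simp add: Fx hprod_smult N_def)
    ultimately have "u \<bullet> F x = 1" using hprod_real[OF u(1)] by fastforce
    then show "y \<in> K \<inter> ?N'"
      using x v \<open>F x \<in> V\<close> F(1) subspace by (auto simp: K_def inner_diff_right subspace_diff)
  next
    fix y assume y: "y \<in> K \<inter> ?N'"
    then have "y + v \<in> V" "u \<bullet> (y + v) = 1"
      using v subspace by (auto simp: K_def inner_add_right subspace_add)
    \<comment> \<open>With this value \<open>G\<close> is division by the \<open>j\<close>th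
      coordinate, which is the chart.\<close>
    then have "?l (y + v) = 1" using hprod_real[OF u(1)] by simp
    then have "G (y + v) = (1 / (y + v) $ j) *s (y + v)" by (simp add: G_def inverse_eq_divide)
    moreover have "(y + v) $ j \<noteq> 0" using y unfolding N_def by blast
    ultimately have "G (y + v) \<in> ?S" using \<open>y + v \<in> V\<close> unfolding chart_image by blast
    then show "y \<in> (\<lambda>x. F x - v) ` (?S \<inter> N)"
      using y G[of "y + v"] by (intro image_eqI[of _ _ "G (y + v)"]) auto
  qed
  moreover have "x \<in> N"
    using u(2) hprod_real[OF u(1) u(1)] \<open>u \<noteq> 0\<close> by (simp add: N_def u(3) hprod_smult)
  ultimately show "\<exists>N N' \<Phi> K. x \<in> N \<and> smooth_diffeo N N' \<Phi> \<and>
      subspace K \<and> dim K = CARD('n) - 1 \<and> \<Phi> ` (?S \<inter> N) = K \<inter> N'"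
    using diffeo K by blast
qed

text \<open>Dividing a curve in the chart by its Hermitian product with \<open>z\<close> moves it
  into \<open>V\<close>, and so its velocity too. Up to a real factor and a complex multiple of
  \<open>z\<close>, which \<open>dchart\<close> kills, this velocity is the lift of
  \<open>\<xi>\<close>. Orthogonality to \<open>z\<close> is what \<open>fubini_study_dchart\<close>
  asks for.\<close>

lemma tangent_subset:
  assumes "z \<in> V" "z $ j \<noteq> 0" "\<xi> \<in> tangent j PV (proj z)"
  shows "\<exists>u\<in>V. z \<bullet> u = 0 \<and> \<xi> = dchart j z u"
proof -
  obtain c e where c: "e > 0" "c ` {-e<..<e} \<subseteq> chart j ` (PV \<inter> chart_dom j)"
    "c 0 = chart j (proj z)" "(c has_vector_derivative \<xi>) (at 0)"
    using assms(3) unfolding tangent_def tangent_vectors_def by blast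
  have c0: "c 0 = (1 / z $ j) *s z" using c(3) assms(2) by (simp add: chart_proj)
  define k where "k = z \<bullet> z"
  have "z \<noteq> 0" using assms(2) by auto
  then have "k \<noteq> 0" by (simp add: k_def)
  have lz: "hprod z z = of_real k" using hprod_real[OF assms(1) assms(1)] by (simp add: k_def)
  define l where "l = hprod z \<xi>"
  let ?\<gamma> = "\<lambda>t. inverse (hprod z (c t)) *s c t"
  \<comment> \<open>The velocity of \<open>?\<gamma>\<close> at \<open>0\<close> by the quotient
    rule, where \<open>hprod z (c 0) = k / z $ j\<close>.\<close>
  define u where "u = (z $ j / k) *s (\<xi> - (l / k) *s z)"
  have "(?\<gamma> has_vector_derivative u) (at 0)"
  proof -
    have "((\<lambda>t. hprod z (c t)) has_derivative (\<lambda>t. hprod z (t *\<^sub>R \<xi>))) (at 0)"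
      using c(4) unfolding has_vector_derivative_def
      by (rule bounded_linear.has_derivative[OF bounded_linear_hprod])
    moreover have "hprod z (c 0) \<noteq> 0"
      using assms(2) \<open>k \<noteq> 0\<close> by (simp add: c0 hprod_smult lz)
    ultimately have "((\<lambda>t. inverse (hprod z (c t))) has_derivative
       (\<lambda>t. - (inverse (hprod z (c 0)) * hprod z (t *\<^sub>R \<xi>) * inverse (hprod z (c 0))))) (at 0)"
      by (rule Deriv.has_derivative_inverse[rotated])
    from bounded_bilinear.FDERIV[OF bounded_bilinear_smult this c(4)[unfolded has_vector_derivative_def]]
    show ?thesis
      unfolding has_vector_derivative_def
      by (rule has_derivative_eq_rhs)
         (use assms(2) \<open>k \<noteq> 0\<close> in \<open>simp add: fun_eq_iff vec_eq_iff u_def l_def c0 hprod_smult lz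
            field_simps flip: of_real_smult\<close>)
  qed
  then have "u \<in> V"
    by (rule has_vector_derivative_in_subspace[OF _ subspace c(1)])
       (use c(2) in \<open>auto intro!: normalized_in_V[OF _ assms(1)] simp: abs_less_iff\<close>)
  \<comment> \<open>Infinitesimal form of \<open>hprod z (?\<gamma> t) = 1\<close> near
    \<open>0\<close>.\<close>
  moreover have "hprod z u = 0"
    using \<open>k \<noteq> 0\<close> by (simp add: u_def hprod_smult hprod_diff lz l_def)
  then have "z \<bullet> u = 0" by (simp add: hprod_eq complex_eq_iff)
  moreover have "k *\<^sub>R u = z $ j *s \<xi> + (- (z $ j * l / k)) *s z"
    using \<open>k \<noteq> 0\<close> by (simp add: u_def vec_eq_iff field_simps flip: of_real_smult)
  then have "dchart j z (k *\<^sub>R u) = \<xi>"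
    using dchart_smult_self[OF assms(2), of "- (z $ j * l / k)"]
      dchart_smult_chart[OF assms(2) tangent_nth[OF assms(3)]] by (simp only: dchart_add) simp
  ultimately show ?thesis
    using subspace by (intro bexI[of _ "k *\<^sub>R u"]) (auto simp: subspace_mul)
qed

lemma PV_cases:
  assumes "p \<in> PV" "p \<in> chart_dom j"
  obtains z where "z \<in> V" "z $ j \<noteq> 0" "p = proj z"
proof -
  obtain z where z: "z \<in> V" "z \<noteq> 0" "p = proj z" using assms(1) by (auto simp: PV_def)
  obtain x where x: "x $ j = 1" "p = proj x" using assms(2) by (auto simp: chart_dom_def)
  then have "x \<noteq> 0" by auto
  with x z have "z $ j \<noteq> 0" by (auto simp: proj_eq_iff proportional_def)
  with z that show ?thesis by blast
qed

lemma lagrangian_submanifold_PV: "lagrangian_submanifold PV"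
  unfolding lagrangian_submanifold_def cproj_submanifold_def
proof (intro conjI allI ballI impI smooth_submanifold_chart)
  fix p j \<xi> \<eta>
  assume "p \<in> PV" "p \<in> chart_dom j" and \<xi>: "\<xi> \<in> tangent j PV p" and \<eta>: "\<eta> \<in> tangent j PV p"
  then obtain z where z: "z \<in> V" "z $ j \<noteq> 0" "p = proj z" by (blast elim: PV_cases)
  obtain u where u: "u \<in> V" "z \<bullet> u = 0" "\<xi> = dchart j z u" using tangent_subset z \<xi> by blast
  obtain v where v: "v \<in> V" "z \<bullet> v = 0" "\<eta> = dchart j z v" using tangent_subset z \<eta> by blast
  show "fubini_study j p \<xi> \<eta> = 0"
    using fubini_study_dchart[OF z(2) u(2) v(2)] isotropic[OF u(1) v(1)] u v z by simp
qed

lemma dchart_in_tangent_PV: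
  assumes "z \<in> V" "z $ j \<noteq> 0" "u \<in> V"
  shows "dchart j z u \<in> tangent j PV (proj z)"
  using assms subspace by (intro dchart_line_in_tangent) (auto simp: PV_def subspace_add subspace_mul)

text \<open>Real rescaling stays in \<open>V\<close>, so the unit sphere of \<open>V\<close> already
  covers \<open>PV\<close>; \<open>proj\<close> is continuous off \<open>0\<close> by definition of
  the quotient topology.\<close>

lemma compact_PV: "compact PV"
proof -
  have "PV = proj ` (sphere 0 1 \<inter> V)"
  proof
    show "PV \<subseteq> proj ` (sphere 0 1 \<inter> V)"
    proof
      fix p assume "p \<in> PV"
      then obtain z where z: "z \<in> V" "z \<noteq> 0" "p = proj z" by (auto simp: PV_def)
      then have "p = proj (of_real (inverse (norm z)) *s z)" by (simp add: proj_scale del: of_real_inverse)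
      moreover have "of_real (inverse (norm z)) *s z \<in> sphere 0 1 \<inter> V"
        using z subspace unfolding of_real_smult by (simp add: subspace_mul)
      ultimately show "p \<in> proj ` (sphere 0 1 \<inter> V)" by blast
    qed
  qed (auto simp: PV_def)
  moreover have "continuous_on (sphere 0 1 \<inter> V) proj"
  proof -
    have "continuous_on {z. z \<noteq> 0} (proj :: complex^'n \<Rightarrow> _)"
      unfolding continuous_on_open_vimage[OF open_Collect_neq[OF continuous_on_id continuous_on_const]]
      by (auto simp: open_cproj_def vimage_def Int_def conj_commute)
    then show ?thesis by (rule continuous_on_subset) auto
  qed
  moreover have "compact (sphere 0 1 \<inter> V)"
    by (intro compact_Int_closed closed_subspace subspace) simp
  ultimately show ?thesis by (simp add: compact_continuous_image)
qed

end


section \<open>The submanifold $\mathcal{L}_2$ and the level set\<close>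

lemma proj_in_level:
  assumes "z \<noteq> 0"
  shows "proj z \<in> level (-1/6) \<longleftrightarrow> 2 * (cmod (z $ 3))\<^sup>2 = (cmod (z $ 1))\<^sup>2 + (cmod (z $ 2))\<^sup>2"
proof -
  have "(cmod (z $ 1))\<^sup>2 + (cmod (z $ 2))\<^sup>2 + (cmod (z $ 3))\<^sup>2 = (norm z)\<^sup>2"
    by (simp add: norm_vec_def L2_set_def sum_3)
  then have "(cmod (z $ 1))\<^sup>2 + (cmod (z $ 2))\<^sup>2 + (cmod (z $ 3))\<^sup>2 \<noteq> 0"
    using assms by simp
  then show ?thesis
    using assms by (auto simp: level_def moment_proj field_simps)
qed

text \<open>To first order \<open>Re c\<close> changes the squared moduli of the first two
  coordinates by opposite amounts, as these moduli agree, while \<open>Im c\<close> only turns a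
  phase.\<close>

lemma dchart_in_tangent_level:
  assumes z: "cmod (z $ 1) = cmod (z $ 3)" "cmod (z $ 2) = cmod (z $ 3)" and j: "z $ j \<noteq> 0"
  shows "dchart j z (vector [c * z $ 1, - of_real (Re c) * z $ 2, 0]) \<in> tangent j (level (-1/6)) (proj z)"
proof -
  \<comment> \<open>The curve \<open>\<gamma>\<close> below is \<open>(F z\<^sub>0, G z\<^sub>1, H z\<^sub>2)\<close> with
    \<open>F = (1 + 2 a t - a\<^sup>2 t\<^sup>2) (1 + i b t)\<close>, \<open>G = (1 - 2 a t - a\<^sup>2 t\<^sup>2) (1 - i b t)\<close> and
    \<open>H = (1 + a\<^sup>2 t\<^sup>2) (1 - i b t)\<close>, which satisfy \<open>|F|\<^sup>2 + |G|\<^sup>2 = 2 |H|\<^sup>2\<close>.  It is a rational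
    parametrization of a rotation of \<open>(z\<^sub>0, z\<^sub>1)\<close> combined with a phase.\<close>
  define a b where "a = Re c / 2" and "b = Im c / 2"
  have c: "c = 2 * of_real a + 2 * \<i> * of_real b"
    by (simp add: a_def b_def complex_eq_iff)
  \<comment> \<open>\<open>v1\<close>, \<open>v2\<close>, \<open>v3\<close> are the coefficients of
    \<open>t\<close>, \<open>t^2\<close>, \<open>t^3\<close> in this curve.\<close>
  define v1 :: "complex^3" where "v1 = vector
    [(2 * of_real a + \<i> * of_real b) * z $ 1, (- 2 * of_real a - \<i> * of_real b) * z $ 2, - \<i> * of_real b * z $ 3]"
  define v2 :: "complex^3" where "v2 = vector
    [(2 * \<i> * of_real (a * b) - of_real (a\<^sup>2)) * z $ 1, (2 * \<i> * of_real (a * b) - of_real (a\<^sup>2)) * z $ 2, of_real (a\<^sup>2) * z $ 3]"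
  define v3 :: "complex^3" where "v3 = vector
    [- \<i> * of_real (a\<^sup>2 * b) * z $ 1, \<i> * of_real (a\<^sup>2 * b) * z $ 2, - \<i> * of_real (a\<^sup>2 * b) * z $ 3]"
  define \<gamma> where "\<gamma> = (\<lambda>t::real. z + t *\<^sub>R v1 + (t * t) *\<^sub>R v2 + (t * t * t) *\<^sub>R v3)"
  have "smooth_on UNIV (\<lambda>t::real. t)"
    by (simp add: smooth_on_bounded_linear)
  then have "smooth_on UNIV \<gamma>"
    unfolding \<gamma>_def
    by (intro smooth_on_add smooth_on_const smooth_on_mult
        smooth_on_bounded_bilinear[OF bounded_bilinear_scaleR]) auto
  moreover have "(\<gamma> has_vector_derivative v1) (at 0)"
    unfolding \<gamma>_def by (auto intro!: derivative_eq_intros)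
  moreover have "proj (\<gamma> t) \<in> level (-1/6)" if "\<gamma> t \<noteq> 0" for t
  proof -
    have "\<gamma> t $ 1 = (of_real (1 + 2 * (a * t) - (a * t)\<^sup>2) * (1 + \<i> * of_real (b * t))) * z $ 1"
      "\<gamma> t $ 2 = (of_real (1 - 2 * (a * t) - (a * t)\<^sup>2) * (1 - \<i> * of_real (b * t))) * z $ 2"
      "\<gamma> t $ 3 = (of_real (1 + (a * t)\<^sup>2) * (1 - \<i> * of_real (b * t))) * z $ 3"
      by (simp_all add: \<gamma>_def v1_def v2_def v3_def scaleR_conv_of_real[where 'a = complex]
          power2_eq_square algebra_simps)
    then have *: "(cmod (\<gamma> t $ 1))\<^sup>2 = (1 + 2 * (a * t) - (a * t)\<^sup>2)\<^sup>2 * (1 + (b * t)\<^sup>2) * (cmod (z $ 3))\<^sup>2"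
      "(cmod (\<gamma> t $ 2))\<^sup>2 = (1 - 2 * (a * t) - (a * t)\<^sup>2)\<^sup>2 * (1 + (b * t)\<^sup>2) * (cmod (z $ 3))\<^sup>2"
      "(cmod (\<gamma> t $ 3))\<^sup>2 = (1 + (a * t)\<^sup>2)\<^sup>2 * (1 + (b * t)\<^sup>2) * (cmod (z $ 3))\<^sup>2"
      unfolding z(1)[symmetric] by (simp_all only: norm_mult power_mult_distrib z norm_of_real power2_abs)
        (simp_all add: cmod_power2 power_mult_distrib)
    show ?thesis
      unfolding proj_in_level[OF that] * by (simp add: power2_eq_square algebra_simps)
  qed
  ultimately have "dchart j z v1 \<in> tangent j (level (-1/6)) (proj z)"
    using j by (intro dchart_in_tangent[where \<gamma> = \<gamma>]) (auto simp: \<gamma>_def)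
  \<comment> \<open>The added multiple of \<open>z\<close> is invisible to \<open>dchart\<close>; it
    cancels the third component and supplies the other half of \<open>Im c\<close> in the
    first.\<close>
  moreover have "vector [c * z $ 1, - of_real (Re c) * z $ 2, 0] = v1 + (\<i> * of_real b) *s z"
    by (simp add: v1_def c vec_eq_iff forall_3 algebra_simps)
  ultimately show ?thesis
    by (simp only: dchart_add dchart_smult_self[OF j]) simp
qed

section \<open>\<open>L2\<close> as a projectivized Lagrangian subspace\<close>

definition V2 :: "(complex^3) set" where
  "V2 = {z. z $ 1 = cnj (z $ 3) \<and> Re (z $ 2) = 0}"

interpretation V2: lagrangian_subspace V2
proof
  show "subspace V2"
    by (auto simp: V2_def subspace_def)
  show "dim V2 = CARD(3)"
  proof -
    define f :: "real^3 \<Rightarrow> complex^3"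
      where "f = (\<lambda>x. vector [Complex (x $ 1) (- x $ 2), Complex 0 (x $ 3), Complex (x $ 1) (x $ 2)])"
    have "linear f"
      by (rule linearI) (simp_all add: f_def vec_eq_iff forall_3 complex_eq_iff)
    moreover have "inj f"
      by (rule injI) (simp add: f_def vec_eq_iff forall_3)
    moreover have "range f = V2"
    proof
      show "V2 \<subseteq> range f"
      proof
        fix z assume "z \<in> V2"
        then show "z \<in> range f"
          by (intro image_eqI[of _ _ "vector [Re (z $ 3), Im (z $ 3), Im (z $ 2)]"])
            (auto simp: V2_def f_def vec_eq_iff forall_3 complex_eq_iff)
      qed
    qed (auto simp: V2_def f_def complex_eq_iff)
    ultimately show ?thesis
      using dim_image_eq[of f UNIV] by simp
  qed
  \<comment> \<open>The first and third terms cancel by conjugation; in the second, a product of two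
    imaginary numbers is real.\<close>
  show "std_form u v = 0" if "u \<in> V2" "v \<in> V2" for u v
    using that by (simp add: V2_def std_form_def sum_3)
qed

lemma sphere_parametrization:
  assumes "(cmod w)\<^sup>2 + s\<^sup>2 = 1"
  shows "\<exists>\<alpha> \<beta>. (cmod \<alpha>)\<^sup>2 + (cmod \<beta>)\<^sup>2 = 1 \<and> \<alpha>\<^sup>2 + \<beta>\<^sup>2 = w \<and> cnj \<alpha> * \<beta> - \<alpha> * cnj \<beta> = \<i> * of_real s"
proof -
  have "s\<^sup>2 \<le> 1"
    unfolding assms[symmetric] by simp
  then have s: "-1 \<le> s" "s \<le> 1"
    by (auto simp: abs_square_le_1 abs_le_iff)
  \<comment> \<open>In the coordinates \<open>p = \<alpha> + i \<beta>\<close>, \<open>q = \<alpha> - i \<beta>\<close> the two expressions become \<open>p q\<close> and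
    \<open>i (|q|\<^sup>2 - |p|\<^sup>2) / 2\<close>, essentially the Hopf map.\<close>
  define p where "p = rcis (sqrt (1 - s)) (Arg w)"
  \<comment> \<open>The norm and the value \<open>s\<close> force \<open>|p|^2 = 1 - s\<close> and
    \<open>|q|^2 = 1 + s\<close>. Only the argument of \<open>p q\<close> matters, so
    \<open>q\<close> is taken real.\<close>
  define q where "q = complex_of_real (sqrt (1 + s))"
  have "(1 - s) * (1 + s) = (cmod w)\<^sup>2"
    using assms by (simp add: algebra_simps power2_eq_square)
  then have "sqrt (1 - s) * sqrt (1 + s) = cmod w"
    by (simp flip: real_sqrt_mult)
  then have "p * q = rcis (cmod w) (Arg w)"
    by (simp add: p_def q_def rcis_def mult.commute mult.left_commute flip: of_real_mult)
  then have pq: "p * q = w" by (simp add: rcis_cmod_Arg)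
  have n: "p * cnj p = of_real (1 - s)" "q * cnj q = of_real (1 + s)"
    using s by (simp_all add: p_def q_def complex_norm_square[symmetric] norm_mult flip: of_real_power of_real_mult)
  define \<alpha> \<beta> where "\<alpha> = (p + q) / 2" and "\<beta> = (q - p) * \<i> / 2"
  have "complex_of_real ((cmod \<alpha>)\<^sup>2 + (cmod \<beta>)\<^sup>2) = (p * cnj p + q * cnj q) / 2"
    unfolding of_real_add complex_norm_square \<alpha>_def \<beta>_def by (simp add: field_simps)
  also have "\<dots> = of_real 1" by (simp add: n)
  finally have "(cmod \<alpha>)\<^sup>2 + (cmod \<beta>)\<^sup>2 = 1" unfolding of_real_eq_iff .
  moreover have "\<alpha>\<^sup>2 + \<beta>\<^sup>2 = p * q"
    by (simp add: \<alpha>_def \<beta>_def power2_eq_square field_simps)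
  moreover have "cnj \<alpha> * \<beta> - \<alpha> * cnj \<beta> = \<i> * (q * cnj q - p * cnj p) / 2"
    by (simp add: \<alpha>_def \<beta>_def field_simps)
  then have "cnj \<alpha> * \<beta> - \<alpha> * cnj \<beta> = \<i> * of_real s"
    unfolding n by simp
  ultimately show ?thesis using pq by blast
qed

lemma L2_eq: "L2 = V2.PV"
proof
  show "L2 \<subseteq> V2.PV"
    using L2_coordinates_nonzero unfolding L2_def V2.PV_def
    by (intro subsetI) (auto intro!: imageI simp: V2_def)
  show "V2.PV \<subseteq> L2"
  proof
    fix p assume "p \<in> V2.PV"
    then obtain z where z: "z \<in> V2" "z \<noteq> 0" "p = proj z" by (auto simp: V2.PV_def)
    define y where "y = Im (z $ 2)"
    have z2: "z $ 2 = \<i> * of_real y" "z $ 1 = cnj (z $ 3)"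
      using z(1) by (auto simp: V2_def y_def complex_eq_iff)
    \<comment> \<open>Chosen so that \<open>z $ 3 / n\<close> and \<open>y / (sqrt 2 * n)\<close>
      form a unit vector; the \<open>sqrt 2\<close> offsets the factor in the second coordinate of
      \<open>L2\<close>.\<close>
    define n where "n = sqrt ((cmod (z $ 3))\<^sup>2 + y\<^sup>2 / 2)"
    have "z $ 3 \<noteq> 0 \<or> y \<noteq> 0" using z(2) z2 by (auto simp: vec_eq_iff forall_3)
    then have "(cmod (z $ 3))\<^sup>2 + y\<^sup>2 / 2 > 0" by (auto intro: add_pos_nonneg add_nonneg_pos)
    then have n: "n > 0" "n\<^sup>2 = (cmod (z $ 3))\<^sup>2 + y\<^sup>2 / 2" by (simp_all add: n_def)
    have "(cmod (z $ 3 / n))\<^sup>2 + (y / (sqrt 2 * n))\<^sup>2 = ((cmod (z $ 3))\<^sup>2 + y\<^sup>2 / 2) / n\<^sup>2"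
      by (simp add: norm_divide power_divide power_mult_distrib add_divide_distrib)
    also have "\<dots> = 1" unfolding n(2)[symmetric] using n(1) by simp
    finally obtain \<alpha> \<beta> where ab: "(cmod \<alpha>)\<^sup>2 + (cmod \<beta>)\<^sup>2 = 1" "\<alpha>\<^sup>2 + \<beta>\<^sup>2 = z $ 3 / n"
      "cnj \<alpha> * \<beta> - \<alpha> * cnj \<beta> = \<i> * of_real (y / (sqrt 2 * n))"
      using sphere_parametrization n(1) by fastforce
    have "cnj (\<alpha>\<^sup>2 + \<beta>\<^sup>2) = z $ 1 / n" unfolding ab(2) z2 by simp
    then have "(cnj \<alpha>)\<^sup>2 + (cnj \<beta>)\<^sup>2 = z $ 1 / n" by simp
    then have "vector [(cnj \<alpha>)\<^sup>2 + (cnj \<beta>)\<^sup>2, of_real (sqrt 2) * (cnj \<alpha> * \<beta> - \<alpha> * cnj \<beta>), \<alpha>\<^sup>2 + \<beta>\<^sup>2]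
      = of_real (1 / n) *s z"
      unfolding ab(2,3) using n(1) by (simp add: vec_eq_iff forall_3 z2(1))
    then have "p = proj (vector [(cnj \<alpha>)\<^sup>2 + (cnj \<beta>)\<^sup>2, of_real (sqrt 2) * (cnj \<alpha> * \<beta> - \<alpha> * cnj \<beta>), \<alpha>\<^sup>2 + \<beta>\<^sup>2])"
      using z n(1) by (simp add: proj_scale)
    then show "p \<in> L2" using ab(1) unfolding L2_def by blast
  qed
qed

section \<open>Intersection with the level set\<close>

lemma L2_level: "L2 \<inter> level (-1/6) = {proj (vector [cnj w, \<i>, w]) |w. cmod w = 1}"
proof (intro set_eqI iffI)
  fix p assume "p \<in> L2 \<inter> level (-1/6)"
  then obtain z where z: "z \<in> V2" "z \<noteq> 0" "p = proj z" "proj z \<in> level (-1/6)"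
    by (auto simp: L2_eq V2.PV_def)
  define y where "y = Im (z $ 2)"
  have z2: "z $ 2 = \<i> * of_real y" "z $ 1 = cnj (z $ 3)"
    using z(1) by (auto simp: V2_def y_def complex_eq_iff)
  have "(cmod (z $ 3))\<^sup>2 = y\<^sup>2"
    using z(4) unfolding proj_in_level[OF z(2)] by (simp add: z2 norm_mult)
  then have y: "cmod (z $ 3) = \<bar>y\<bar>" by (intro power2_eq_imp_eq[of "cmod (z $ 3)"]) simp_all
  then have "y \<noteq> 0" using z(2) z2 by (auto simp: vec_eq_iff forall_3)
  \<comment> \<open>Division by the real number \<open>y\<close>, of either sign, stays in
    \<open>V2\<close> and turns the second coordinate into \<open>\<i>\<close>.\<close>
  then have "cmod (z $ 3 / y) = 1" "z = of_real y *s vector [cnj (z $ 3 / y), \<i>, z $ 3 / y]"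
    using y by (simp_all add: norm_divide vec_eq_iff forall_3 z2)
  moreover have "vector [cnj (z $ 3 / y), \<i>, z $ 3 / y] \<noteq> (0 :: complex^3)"
    by (simp add: vec_eq_iff forall_3)
  ultimately have "p = proj (vector [cnj (z $ 3 / y), \<i>, z $ 3 / y])"
    using \<open>y \<noteq> 0\<close> z(3) by (metis of_real_eq_0_iff proj_scale)
  with \<open>cmod (z $ 3 / y) = 1\<close> show "p \<in> {proj (vector [cnj w, \<i>, w]) |w. cmod w = 1}" by blast
next
  fix p :: "3 cproj" assume "p \<in> {proj (vector [cnj w, \<i>, w]) |w. cmod w = 1}"
  then obtain w where w: "p = proj (vector [cnj w, \<i>, w])" "cmod w = 1" by blast
  have nonzero: "vector [cnj w, \<i>, w] \<noteq> (0 :: complex^3)" by (simp add: vec_eq_iff forall_3)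
  moreover have "vector [cnj w, \<i>, w] \<in> V2" by (simp add: V2_def)
  ultimately have "p \<in> L2" unfolding w(1) L2_eq V2.PV_def by blast
  moreover have "p \<in> level (-1/6)" unfolding w(1) proj_in_level[OF nonzero] using w(2) by simp
  ultimately show "p \<in> L2 \<inter> level (-1/6)" by blast
qed

section \<open>Transversality\<close>

lemma transverse_L2: "transverse L2 (level (-1/6))"
  unfolding transverse_def
proof (intro ballI allI impI)
  fix p :: "3 cproj" and j :: 3
  assume "p \<in> L2 \<inter> level (-1/6)" "p \<in> chart_dom j"
  then obtain w where w: "cmod w = 1" and p: "p = proj (vector [cnj w, \<i>, w])"
    unfolding L2_level by blast
  define z :: "complex^3" where "z = vector [cnj w, \<i>, w]"
  have "w \<noteq> 0" using w by auto
  then have j: "z $ j \<noteq> 0" using exhaust_3[of j] by (auto simp: z_def)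
  have z: "z \<in> V2" "p = proj z" by (simp_all add: z_def V2_def p)
  show "{\<xi> + \<eta> |\<xi> \<eta>. \<xi> \<in> tangent j L2 p \<and> \<eta> \<in> tangent j (level (-1/6)) p} = tangent j UNIV p"
  proof
    show "{\<xi> + \<eta> |\<xi> \<eta>. \<xi> \<in> tangent j L2 p \<and> \<eta> \<in> tangent j (level (-1/6)) p} \<subseteq> tangent j UNIV p"
      by (auto simp: z(2) tangent_UNIV[OF j] dest!: tangent_nth)
    show "tangent j UNIV p \<subseteq> {\<xi> + \<eta> |\<xi> \<eta>. \<xi> \<in> tangent j L2 p \<and> \<eta> \<in> tangent j (level (-1/6)) p}"
    proof
      fix \<xi> assume "\<xi> \<in> tangent j UNIV p"
      then have "\<xi> $ j = 0" by (rule tangent_nth)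
      define \<zeta> where "\<zeta> = z $ j *s \<xi>"
      \<comment> \<open>\<open>k\<close> and \<open>c\<close> solve the equations of \<open>V2\<close> for \<open>u\<close>.\<close>
      define k where "k = - Re (\<zeta> $ 2)"
      \<comment> \<open>Since \<open>z $ 2 = \<i>\<close>, the vector \<open>\<eta>\<close> leaves
        the real part of the second coordinate alone. That part thus fixes \<open>k\<close>, and the
        other equation then fixes \<open>c\<close>.\<close>
      define c where "c = (\<zeta> $ 1 - cnj (\<zeta> $ 3)) / cnj w - 2 * \<i> * of_real k"
      define \<eta> :: "complex^3" where "\<eta> = vector [c * z $ 1, - of_real (Re c) * z $ 2, 0]"
      define u where "u = \<zeta> - (\<i> * of_real k) *s z - \<eta>"
      have "cnj w * c = \<zeta> $ 1 - cnj (\<zeta> $ 3) - 2 * \<i> * of_real k * cnj w"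
        using \<open>w \<noteq> 0\<close> by (simp add: c_def field_simps)
      then have "u \<in> V2"
        by (simp add: V2_def u_def \<eta>_def z_def k_def algebra_simps)
      have "\<zeta> = u + ((\<i> * of_real k) *s z + \<eta>)" by (simp add: u_def)
      then have "dchart j z \<zeta> = dchart j z u + dchart j z \<eta>"
        by (simp only: dchart_add dchart_smult_self[OF j]) simp
      moreover have "dchart j z \<zeta> = \<xi>"
        unfolding \<zeta>_def using j \<open>\<xi> $ j = 0\<close> by (rule dchart_smult_chart)
      moreover have "dchart j z u \<in> tangent j L2 p"
        unfolding L2_eq z(2) using z(1) j \<open>u \<in> V2\<close> by (rule V2.dchart_in_tangent_PV)
      moreover have "dchart j z \<eta> \<in> tangent j (level (-1/6)) p"
        unfolding \<eta>_def z(2) using w j by (intro dchart_in_tangent_level) (simp_all add: z_def)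
      ultimately show "\<xi> \<in> {\<xi> + \<eta> |\<xi> \<eta>. \<xi> \<in> tangent j L2 p \<and> \<eta> \<in> tangent j (level (-1/6)) p}"
        by blast
    qed
  qed
qed

section \<open>The image in the projective line\<close>

lemma reduced_L2_point:
  "reduced_to_CP1 (orbit (proj (vector [cnj w, \<i>, w]))) = proj (vector [cnj w, \<i>])"
  using reduced_to_CP1_orbit[of "vector [cnj w, \<i>, w]"] by simp

text \<open>In \<open>[cnj w : \<i>]\<close> the fixed second coordinate rules out rescaling, so the
  orbit determines \<open>w\<close>.\<close>

lemma inj_on_orbit_L2: "inj_on orbit (L2 \<inter> level (-1/6))"
proof (rule inj_onI)
  fix p q assume "p \<in> L2 \<inter> level (-1/6)" "q \<in> L2 \<inter> level (-1/6)" and eq: "orbit p = orbit q"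
  then obtain w w' where p: "p = proj (vector [cnj w, \<i>, w])" and q: "q = proj (vector [cnj w', \<i>, w'])"
    unfolding L2_level by blast
  have "proj (vector [cnj w, \<i>]) = (proj (vector [cnj w', \<i>]) :: 2 cproj)"
    using eq reduced_L2_point unfolding p q by metis
  moreover have "vector [cnj w, \<i>] \<noteq> (0 :: complex^2)" for w
    by (simp add: vec_eq_iff forall_2)
  ultimately have "w = w'"
    by (auto simp: proj_eq_iff proportional_def vec_eq_iff forall_2)
  then show "p = q" by (simp add: p q)
qed

lemma great_circle_reduced_L2: "great_circle (reduced_to_CP1 ` orbit ` (L2 \<inter> level (-1/6)))"
proof -
  have eq: "reduced_to_CP1 ` orbit ` (L2 \<inter> level (-1/6)) = {proj (vector [cnj w, \<i>]) |w. cmod w = 1}"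
    unfolding L2_level by (auto simp: image_iff reduced_L2_point) (metis reduced_L2_point)
  \<comment> \<open>The third coordinate of \<open>to_sphere\<close> is the difference of the
    squared moduli over the squared norm.\<close>
  have equator: "axis 3 1 \<bullet> to_sphere (proj z) = 0 \<longleftrightarrow> cmod (z $ 1) = cmod (z $ 2)" if "z \<noteq> 0" for z
    using that by (simp add: to_sphere_proj inner_axis')
  have "{proj (vector [cnj w, \<i>]) |w. cmod w = 1} = {p. axis 3 1 \<bullet> to_sphere p = 0}"
  proof (intro set_eqI iffI)
    fix p :: "2 cproj" assume "p \<in> {proj (vector [cnj w, \<i>]) |w. cmod w = 1}"
    then obtain w where w: "p = proj (vector [cnj w, \<i>])" "cmod w = 1" by blast
    have "vector [cnj w, \<i>] \<noteq> (0 :: complex^2)" by (simp add: vec_eq_iff forall_2)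
    then show "p \<in> {p. axis 3 1 \<bullet> to_sphere p = 0}"
      using w by (simp add: equator)
  next
    fix p :: "2 cproj" assume p: "p \<in> {p. axis 3 1 \<bullet> to_sphere p = 0}"
    obtain z where z: "z \<noteq> 0" "p = proj z" by (rule proj_cases)
    then have n: "cmod (z $ 1) = cmod (z $ 2)" using p equator by simp
    then have z2: "z $ 2 \<noteq> 0" using z(1) by (auto simp: vec_eq_iff forall_2)
    \<comment> \<open>Read off after rescaling \<open>z\<close> so that its second coordinate is
      \<open>\<i>\<close>.\<close>
    define w where "w = cnj (\<i> * z $ 1 / z $ 2)"
    have "cmod w = 1" using n z2 by (simp add: w_def norm_divide norm_mult)
    moreover have "vector [cnj w, \<i>] = (\<i> / z $ 2) *s z"
      using z2 by (simp add: w_def vec_eq_iff forall_2)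
    then have "p = proj (vector [cnj w, \<i>])" using z z2 by (simp add: proj_scale)
    ultimately show "p \<in> {proj (vector [cnj w, \<i>]) |w. cmod w = 1}" by blast
  qed
  then show ?thesis
    unfolding great_circle_def eq by (intro exI[of _ "axis 3 1"]) (simp add: axis_eq_0_iff)
qed

theorem corollary3p5:
  shows "\<exists>l. one_to_one_transverse_lifting (-1/6) L2 l \<and> great_circle (reduced_to_CP1 ` l)"
  unfolding one_to_one_transverse_lifting_def
  using V2.compact_PV V2.lagrangian_submanifold_PV transverse_L2 inj_on_orbit_L2 great_circle_reduced_L2
  unfolding L2_eq by blast

end
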